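(* Let $T>0$, $r>0$, $\theta\in(0,1]$, let $\eta:[-r,0]\to\mathbb R_+$ be $\theta$-Hölder continuous, let $b:[0,T]\times\mathcal C_r\to\mathbb R$ and $\sigma:[0,T]\times\mathbb R\to\mathbb R$ be such that $b$ and the functional $(t,\varphi)\mapsto\sigma(t,\varphi(-r))$ on $[0,T]\times\mathcal C_r$ satisfy the assumptions on the drift coefficient and on the diffusion coefficient, respectively, listed in the context, with $\beta\in(0,1)$ the time-Hölder exponent of the diffusion coefficient. Let $0<\alpha<\frac12\wedge\theta\wedge\beta$ and let $g\in W^{1-\alpha,\infty}_{[0,T]}$. Then the equation $$x(t)=\eta(0)+\int_0^t b(s,x_s)\,ds+\int_0^t\sigma(s,x(s-r))\,dg_s+y(t),\quad t\in[0,T],\qquad x(t)=\eta(t),\quad t\in[-r,0],$$ with $$y(t)=\sup_{0\le s\le t}\big(z(s)\big)^-,\qquad z(t)=\eta(0)+\int_0^t b(s,x_s)\,ds+\int_0^t\sigma(s,x(s-r))\,dg_s,$$ has a unique solution.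
   Context: Notation: $a^-=\max(-a,0)$, $a\wedge b=\min(a,b)$. $\mathcal C_r=C([-r,0],\mathbb R)$ with the sup norm $\|\cdot\|_{\mathcal C_r}$. For $x:[-r,T]\to\mathbb R$ continuous and $t\in[0,T]$, $x_t\in\mathcal C_r$ is $x_t(s)=x(t+s)$, $s\in[-r,0]$; in particular $x_t(-r)=x(t-r)$. Assumptions on the drift coefficient $b:[0,T]\times\mathcal C_r\to\mathbb R$: $b$ is measurable and there are constants with $|b(t,x)|\le L_b^2(1+\|x\|_{\mathcal C_r})$ and $|b(t,x)-b(t,y)|\le L_b^1\|x-y\|_{\mathcal C_r}$ for all $t\in[0,T]$, $x,y\in\mathcal C_r$. Assumptions on a diffusion coefficient $S:[0,T]\times\mathcal C_r\to\mathbb R$ (here $S(t,\varphi)=\sigma(t,\varphi(-r))$): there are constants and $\beta\in(0,1)$ with $|S(t,x)|\le L_\sigma^1(1+\|x\|_{\mathcal C_r})$, $|S(t,x)-S(s,x)|\le L_\sigma^3|t-s|^\beta(1+\|x\|_{\mathcal C_r})$, $|S(t,x)-S(t,y)|\le L_\sigma^2\|x-y\|_{\mathcal C_r}$ for all $s,t\in[0,T]$, $x,y\in\mathcal C_r$. $W^{1-\alpha,\infty}_{[0,T]}$ is the space of measurable $g:[0,T]\to\mathbb R$ with $$\sup_{0\le u<v\le T}\Big(\frac{|g(v)-g(u)|}{(v-u)^{1-\alpha}}+\int_u^v\frac{|g(y)-g(u)|}{(y-u)^{2-\alpha}}dy\Big)<\infty .$$ Integral with respect to $g$ (generalized Lebesgue–Stieltjes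 integral in the sense of Zähle): $$\int_a^b f\,dg:=(-1)^\alpha\int_a^b D^\alpha_{a+}f(x)\,D^{1-\alpha}_{b-}g_{b-}(x)\,dx,\qquad g_{b-}(x)=g(x)-g(b-),$$ whenever $D^\alpha_{a+}f\in L^1[a,b]$ and $D^{1-\alpha}_{b-}g_{b-}\in L^\infty[a,b]$, and $\int_c^d f\,dg:=\int_a^b \mathbf 1_{(c,d)}f\,dg$ for $a\le c<d\le b$. The Weyl–Marchaud derivatives are, for $x\in(a,b)$, $$D_{a+}^{\alpha}f(x)=\frac{1}{\Gamma(1-\alpha)}\Big(\frac{f(x)}{(x-a)^{\alpha}}+\alpha\int_a^x\frac{f(x)-f(y)}{(x-y)^{\alpha+1}}dy\Big),\quad D_{b-}^{\alpha}f(x)=\frac{(-1)^\alpha}{\Gamma(1-\alpha)}\Big(\frac{f(x)}{(b-x)^{\alpha}}+\alpha\int_x^b\frac{f(x)-f(y)}{(y-x)^{\alpha+1}}dy\Big).$$ A solution is a continuous function on $[-r,T]$ for which all integrals are defined and the equation holds for all $t$. *)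

theory Defs
  imports "HOL-Analysis.Analysis"
begin

section \<open>Path spaces\<close>

text \<open>The space \<open>C([a,b], \<real>)\<close> with the uniform metric. Its elements are functions on \<open>\<real>\<close> that
  are \<^const>\<open>undefined\<close> outside \<open>[a,b]\<close> (extensional), so that equality of elements
  is equality on \<open>[a,b]\<close>.\<close>

definition path_space :: "real \<Rightarrow> real \<Rightarrow> (real \<Rightarrow> real) metric" where
  "path_space a b = cfunspace (top_of_set {a..b}) euclidean_metric"

lemma mspace_path_space:
  "mspace (path_space a b) = {f. f \<in> extensional {a..b} \<and> continuous_on {a..b} f}"
proof -
  have "bounded (f ` {a..b})" if "continuous_on {a..b} f" for f :: "real \<Rightarrow> real"
    using compact_continuous_image[OF that compact_Icc] by (rule compact_imp_bounded)
  then show ?thesis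
    by (auto simp: path_space_def mbounded_iff_bounded)
qed

definition hist_space :: "real \<Rightarrow> (real \<Rightarrow> real) metric" where
  "hist_space r = path_space (-r) 0"

definition hist_norm :: "real \<Rightarrow> (real \<Rightarrow> real) \<Rightarrow> real" where
  "hist_norm r \<phi> = (SUP s\<in>{-r..0}. \<bar>\<phi> s\<bar>)"

definition hist_borel :: "real \<Rightarrow> (real \<Rightarrow> real) measure" where
  "hist_borel r = sigma (mspace (hist_space r)) {U. openin (mtopology_of (hist_space r)) U}"

definition segment :: "real \<Rightarrow> (real \<Rightarrow> real) \<Rightarrow> real \<Rightarrow> (real \<Rightarrow> real)" where
  "segment r x t = restrict (\<lambda>s. x (t + s)) {-r..0}"


section \<open>Assumptions on the data\<close>

definition holder_on :: "real \<Rightarrow> real set \<Rightarrow> (real \<Rightarrow> real) \<Rightarrow> bool" where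
  "holder_on \<theta> A f \<longleftrightarrow> (\<exists>C. \<forall>s\<in>A. \<forall>t\<in>A. \<bar>f t - f s\<bar> \<le> C * \<bar>t - s\<bar> powr \<theta>)"

text \<open>Measurability of the drift is Borel measurability on \<open>[0,T] \<times> C([-r,0], \<real>)\<close>. Only the values
  of a coefficient on \<open>[0,T]\<close> times the path space matter.\<close>

definition drift_coeff :: "real \<Rightarrow> real \<Rightarrow> (real \<Rightarrow> (real \<Rightarrow> real) \<Rightarrow> real) \<Rightarrow> bool" where
  "drift_coeff r T b \<longleftrightarrow>
     (\<lambda>(t, \<phi>). b t \<phi>) \<in> borel_measurable (restrict_space borel {0..T} \<Otimes>\<^sub>M hist_borel r) \<and>
     (\<exists>L2. \<forall>t\<in>{0..T}. \<forall>\<phi>\<in>mspace (hist_space r). \<bar>b t \<phi>\<bar> \<le> L2 * (1 + hist_norm r \<phi>)) \<and>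
     (\<exists>L1. \<forall>t\<in>{0..T}. \<forall>\<phi>\<in>mspace (hist_space r). \<forall>\<psi>\<in>mspace (hist_space r).
        \<bar>b t \<phi> - b t \<psi>\<bar> \<le> L1 * hist_norm r (\<lambda>s. \<phi> s - \<psi> s))"

definition diffusion_coeff :: "real \<Rightarrow> real \<Rightarrow> real \<Rightarrow> (real \<Rightarrow> (real \<Rightarrow> real) \<Rightarrow> real) \<Rightarrow> bool" where
  "diffusion_coeff r T \<beta> S \<longleftrightarrow>
     (\<exists>L1. \<forall>t\<in>{0..T}. \<forall>\<phi>\<in>mspace (hist_space r). \<bar>S t \<phi>\<bar> \<le> L1 * (1 + hist_norm r \<phi>)) \<and>
     (\<exists>L3. \<forall>s\<in>{0..T}. \<forall>t\<in>{0..T}. \<forall>\<phi>\<in>mspace (hist_space r).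
        \<bar>S t \<phi> - S s \<phi>\<bar> \<le> L3 * \<bar>t - s\<bar> powr \<beta> * (1 + hist_norm r \<phi>)) \<and>
     (\<exists>L2. \<forall>t\<in>{0..T}. \<forall>\<phi>\<in>mspace (hist_space r). \<forall>\<psi>\<in>mspace (hist_space r).
        \<bar>S t \<phi> - S t \<psi>\<bar> \<le> L2 * hist_norm r (\<lambda>s. \<phi> s - \<psi> s))"

text \<open>The space \<open>W\<close> with exponents \<open>1 - \<alpha>, \<infinity>\<close> on \<open>[0,T]\<close>; the supremum is taken in \<open>[0,\<infinity>]\<close>.\<close>

definition W_space :: "real \<Rightarrow> real \<Rightarrow> (real \<Rightarrow> real) set" where
  "W_space \<alpha> T = {g. g \<in> borel_measurable (lebesgue_on {0..T}) \<and>
     (SUP (u, v) \<in> {(u, v). 0 \<le> u \<and> u < v \<and> v \<le> T}.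
        ennreal (\<bar>g v - g u\<bar> / (v - u) powr (1 - \<alpha>)) +
        (\<integral>\<^sup>+ y. ennreal (\<bar>g y - g u\<bar> / (y - u) powr (2 - \<alpha>)) \<partial>lebesgue_on {u<..<v})) < \<infinity>}"


section \<open>Generalized Lebesgue--Stieltjes integral\<close>

text \<open>Weyl--Marchaud derivatives. The right-sided one carries the complex factor \<open>(-1)\<^sup>\<alpha>\<close>, which
  is \<open>exp (\<i> \<pi> \<alpha>)\<close> for the principal branch used by \<^const>\<open>powr\<close>.\<close>

definition WM_left :: "real \<Rightarrow> real \<Rightarrow> (real \<Rightarrow> real) \<Rightarrow> real \<Rightarrow> real" where
  "WM_left \<alpha> a f x = 1 / Gamma (1 - \<alpha>) *
     (f x / (x - a) powr \<alpha> +
      \<alpha> * (\<integral>y. (f x - f y) / (x - y) powr (\<alpha> + 1) \<partial>lebesgue_on {a<..<x}))"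

definition WM_right :: "real \<Rightarrow> real \<Rightarrow> (real \<Rightarrow> real) \<Rightarrow> real \<Rightarrow> complex" where
  "WM_right \<alpha> b f x = (-1) powr complex_of_real \<alpha> / complex_of_real (Gamma (1 - \<alpha>)) *
     complex_of_real (f x / (b - x) powr \<alpha> +
      \<alpha> * (\<integral>y. (f x - f y) / (y - x) powr (\<alpha> + 1) \<partial>lebesgue_on {x<..<b}))"

text \<open>Since the Bochner integral of a non-integrable function is \<open>0\<close>, existence of the inner
  integrals (almost everywhere) has to be required explicitly.\<close>

definition WM_left_exists :: "real \<Rightarrow> real \<Rightarrow> real \<Rightarrow> (real \<Rightarrow> real) \<Rightarrow> bool" where
  "WM_left_exists \<alpha> a b f \<longleftrightarrow> (AE x in lebesgue_on {a<..<b}.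
     integrable (lebesgue_on {a<..<x}) (\<lambda>y. (f x - f y) / (x - y) powr (\<alpha> + 1)))"

definition WM_right_exists :: "real \<Rightarrow> real \<Rightarrow> real \<Rightarrow> (real \<Rightarrow> real) \<Rightarrow> bool" where
  "WM_right_exists \<alpha> a b f \<longleftrightarrow> (AE x in lebesgue_on {a<..<b}.
     integrable (lebesgue_on {x<..<b}) (\<lambda>y. (f x - f y) / (y - x) powr (\<alpha> + 1)))"

definition minus_left_limit :: "(real \<Rightarrow> real) \<Rightarrow> real \<Rightarrow> real \<Rightarrow> real" where
  "minus_left_limit g b x = g x - Lim (at_left b) g"

definition GLS_defined :: "real \<Rightarrow> real \<Rightarrow> real \<Rightarrow> (real \<Rightarrow> real) \<Rightarrow> (real \<Rightarrow> real) \<Rightarrow> bool" where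
  "GLS_defined \<alpha> a b f g \<longleftrightarrow>
     WM_left_exists \<alpha> a b f \<and>
     integrable (lebesgue_on {a<..<b}) (WM_left \<alpha> a f) \<and>
     (\<exists>l. (g \<longlongrightarrow> l) (at_left b)) \<and>
     WM_right_exists (1 - \<alpha>) a b (minus_left_limit g b) \<and>
     WM_right (1 - \<alpha>) b (minus_left_limit g b) \<in> borel_measurable (lebesgue_on {a<..<b}) \<and>
     (\<exists>M. AE x in lebesgue_on {a<..<b}. norm (WM_right (1 - \<alpha>) b (minus_left_limit g b) x) \<le> M)"

definition GLS_integral_complex ::
    "real \<Rightarrow> real \<Rightarrow> real \<Rightarrow> (real \<Rightarrow> real) \<Rightarrow> (real \<Rightarrow> real) \<Rightarrow> complex" where
  "GLS_integral_complex \<alpha> a b f g = (-1) powr complex_of_real \<alpha> *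
     (\<integral>x. complex_of_real (WM_left \<alpha> a f x) * WM_right (1 - \<alpha>) b (minus_left_limit g b) x
        \<partial>lebesgue_on {a<..<b})"

definition GLS_integral :: "real \<Rightarrow> real \<Rightarrow> real \<Rightarrow> (real \<Rightarrow> real) \<Rightarrow> (real \<Rightarrow> real) \<Rightarrow> real" where
  "GLS_integral \<alpha> a b f g = Re (GLS_integral_complex \<alpha> a b f g)"

text \<open>Taking the real part loses nothing: the complex factors multiply to \<open>-1\<close>.\<close>

lemma of_real_GLS_integral:
  "complex_of_real (GLS_integral \<alpha> a b f g) = GLS_integral_complex \<alpha> a b f g"
proof -
  define R where "R x = 1 / Gamma \<alpha> * (minus_left_limit g b x / (b - x) powr (1 - \<alpha>) + (1 - \<alpha>) *
     (\<integral>y. (minus_left_limit g b x - minus_left_limit g b y) / (y - x) powr (1 - \<alpha> + 1)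
        \<partial>lebesgue_on {x<..<b}))" for x
  have R: "WM_right (1 - \<alpha>) b (minus_left_limit g b) x
      = (-1) powr complex_of_real (1 - \<alpha>) * complex_of_real (R x)" for x
    by (simp add: WM_right_def R_def)
  have "(-1::complex) powr complex_of_real \<alpha> * (-1) powr complex_of_real (1 - \<alpha>) = -1"
    by (simp flip: powr_add)
  moreover have "GLS_integral_complex \<alpha> a b f g =
      (-1) powr complex_of_real \<alpha> * (\<integral>x. (-1) powr complex_of_real (1 - \<alpha>) *
        complex_of_real (WM_left \<alpha> a f x * R x) \<partial>lebesgue_on {a<..<b})"
    unfolding GLS_integral_complex_def R by (simp add: mult_ac)
  ultimately have "GLS_integral_complex \<alpha> a b f g =
      complex_of_real (- (\<integral>x. WM_left \<alpha> a f x * R x \<partial>lebesgue_on {a<..<b}))"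
    by (simp del: of_real_mult of_real_diff add: mult.assoc[symmetric])
  then show ?thesis
    by (simp add: GLS_integral_def)
qed

text \<open>The integral over a subinterval \<open>(c,d)\<close> of the base interval \<open>[a,b]\<close>.\<close>

definition GLS_sub_defined ::
    "real \<Rightarrow> real \<Rightarrow> real \<Rightarrow> real \<Rightarrow> real \<Rightarrow> (real \<Rightarrow> real) \<Rightarrow> (real \<Rightarrow> real) \<Rightarrow> bool" where
  "GLS_sub_defined \<alpha> a b c d f g \<longleftrightarrow> GLS_defined \<alpha> a b (\<lambda>s. indicator {c<..<d} s * f s) g"

definition GLS_sub_integral ::
    "real \<Rightarrow> real \<Rightarrow> real \<Rightarrow> real \<Rightarrow> real \<Rightarrow> (real \<Rightarrow> real) \<Rightarrow> (real \<Rightarrow> real) \<Rightarrow> real" where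
  "GLS_sub_integral \<alpha> a b c d f g = GLS_integral \<alpha> a b (\<lambda>s. indicator {c<..<d} s * f s) g"


section \<open>The reflected delay equation\<close>

definition unreflected ::
    "real \<Rightarrow> real \<Rightarrow> real \<Rightarrow> (real \<Rightarrow> real) \<Rightarrow> (real \<Rightarrow> (real \<Rightarrow> real) \<Rightarrow> real) \<Rightarrow> (real \<Rightarrow> real \<Rightarrow> real) \<Rightarrow>
     (real \<Rightarrow> real) \<Rightarrow> (real \<Rightarrow> real) \<Rightarrow> real \<Rightarrow> real" where
  "unreflected \<alpha> r T \<eta> b \<sigma> g x t =
     \<eta> 0 + (\<integral>s. b s (segment r x s) \<partial>lebesgue_on {0..t})
         + GLS_sub_integral \<alpha> 0 T 0 t (\<lambda>s. \<sigma> s (x (s - r))) g"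

definition regulator :: "(real \<Rightarrow> real) \<Rightarrow> real \<Rightarrow> real" where
  "regulator z t = (SUP s\<in>{0..t}. max (- z s) 0)"

text \<open>The boundedness clause says that the supremum in the regulator term is a real number;
  \<^const>\<open>Sup\<close> on the reals is unspecified for unbounded sets.\<close>

definition reflected_delay_solution ::
    "real \<Rightarrow> real \<Rightarrow> real \<Rightarrow> (real \<Rightarrow> real) \<Rightarrow> (real \<Rightarrow> (real \<Rightarrow> real) \<Rightarrow> real) \<Rightarrow> (real \<Rightarrow> real \<Rightarrow> real) \<Rightarrow>
     (real \<Rightarrow> real) \<Rightarrow> (real \<Rightarrow> real) \<Rightarrow> bool" where
  "reflected_delay_solution \<alpha> r T \<eta> b \<sigma> g x \<longleftrightarrow>
     x \<in> mspace (path_space (-r) T) \<and>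
     (\<forall>t\<in>{0..T}. integrable (lebesgue_on {0..t}) (\<lambda>s. b s (segment r x s))) \<and>
     (\<forall>t\<in>{0..T}. GLS_sub_defined \<alpha> 0 T 0 t (\<lambda>s. \<sigma> s (x (s - r))) g) \<and>
     bdd_above ((\<lambda>s. max (- unreflected \<alpha> r T \<eta> b \<sigma> g x s) 0) ` {0..T}) \<and>
     (\<forall>t\<in>{0..T}. x t = unreflected \<alpha> r T \<eta> b \<sigma> g x t
                      + regulator (unreflected \<alpha> r T \<eta> b \<sigma> g x) t) \<and>
     (\<forall>t\<in>{-r..0}. x t = \<eta> t)"

end

theory Submission
  imports Defs
begin

text \<open>Put \<open>\<mu> = min \<beta> (min \<theta> (1 - \<alpha>)) > \<alpha>\<close>. If \<open>f\<close> is \<open>\<mu>\<close>-Hoelder, then the difference of the left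
  Weyl--Marchaud derivatives of \<open>1\<^bsub>(0,t)\<^esub> f\<close> and \<open>1\<^bsub>(0,s)\<^esub> f\<close> has \<open>L\<^sup>1\<close>-norm of order
  \<open>(t - s) powr (1 - \<alpha>)\<close>, by an explicit pointwise estimate. As the right derivative of an integrator
  in \<open>W\<close> is bounded, \<open>t \<mapsto> \<integral>\<^sub>0\<^sup>t f dg\<close> is \<open>(1 - \<alpha>)\<close>-Hoelder; neither additivity of the integral nor
  fractional integration by parts is needed.

  The regulator map is Lipschitz for the uniform norm and preserves Hoelder continuity, so for a fixed
  \<open>\<mu>\<close>-Hoelder driver \<open>m\<close> in place of the \<open>dg\<close>-integral the reflected equation has exactly one
  solution by the contraction principle in an exponentially weighted norm, and that solution is again
  \<open>\<mu>\<close>-Hoelder.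

  Because of the delay, the \<open>dg\<close>-integral on \<open>[0,(n+1)r]\<close> only involves the path on \<open>[-r,nr]\<close>.
  Hence the map sending a path \<open>x\<close> to the solution driven by \<open>\<integral> \<sigma>(s, x(s - r)) dg\<close> extends the
  horizon up to which two paths agree by \<open>r\<close>; iterating it reaches a fixed point after finitely many
  steps, and two fixed points coincide.\<close>

section \<open>Kernel integrals\<close>

text \<open>The upper limit \<open>u = x\<close> is allowed. For \<open>p < 1\<close> the kernel is
  singular there, but the primitive stays continuous because \<open>p > 0\<close>, so
  differentiability in the interior suffices.\<close>

lemma has_integral_left_kernel:
  fixes s u x p :: real
  assumes "s \<le> u" "u \<le> x" "p > 0"
  shows "((\<lambda>y. (x - y) powr (p - 1)) has_integral ((x - s) powr p - (x - u) powr p) / p) {s..u}"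
proof -
  have "((\<lambda>y. (x - y) powr (p - 1)) has_integral
      (- ((x - u) powr p / p)) - (- ((x - s) powr p / p))) {s..u}"
  proof (rule fundamental_theorem_of_calculus_interior[OF \<open>s \<le> u\<close>])
    show "continuous_on {s..u} (\<lambda>y. - ((x - y) powr p / p))"
      using assms by (intro continuous_intros continuous_on_powr') auto
    fix y assume "y \<in> {s<..<u}"
    then have "((\<lambda>y. - ((x - y) powr p / p)) has_real_derivative (x - y) powr (p - 1)) (at y)"
      using assms by (auto intro!: derivative_eq_intros simp: powr_diff field_simps)
    then show "((\<lambda>y. - ((x - y) powr p / p)) has_vector_derivative (x - y) powr (p - 1)) (at y)"
      by (simp add: has_real_derivative_iff_has_vector_derivative)
  qed
  then show ?thesis
    by (simp add: diff_divide_distrib)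
qed

text \<open>The exponent lies below -1, so the kernel is not integrable up to its singularity; hence
  \<open>u < x\<close> strictly.\<close>

lemma has_integral_singular_kernel:
  fixes s u x a :: real
  assumes "s \<le> u" "u < x" "a > 0"
  shows "((\<lambda>y. a * (x - y) powr (- a - 1)) has_integral ((x - u) powr (- a) - (x - s) powr (- a))) {s..u}"
proof (rule fundamental_theorem_of_calculus[OF \<open>s \<le> u\<close>])
  fix y assume "y \<in> {s..u}"
  then have "((\<lambda>y. (x - y) powr (- a)) has_real_derivative a * (x - y) powr (- a - 1)) (at y within {s..u})"
    using assms by (auto intro!: derivative_eq_intros simp: powr_diff field_simps)
  then show "((\<lambda>y. (x - y) powr (- a)) has_vector_derivative a * (x - y) powr (- a - 1)) (at y within {s..u})"
    by (simp add: has_real_derivative_iff_has_vector_derivative)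
qed

lemma has_integral_right_kernel:
  fixes s u w p :: real
  assumes "w \<le> s" "s \<le> u" "p > 0"
  shows "((\<lambda>x. (x - w) powr (p - 1)) has_integral ((u - w) powr p - (s - w) powr p) / p) {s..u}"
proof -
  have "((\<lambda>x. (x - w) powr (p - 1)) has_integral (u - w) powr p / p - (s - w) powr p / p) {s..u}"
  proof (rule fundamental_theorem_of_calculus_interior[OF \<open>s \<le> u\<close>])
    show "continuous_on {s..u} (\<lambda>x. (x - w) powr p / p)"
      using assms by (intro continuous_intros continuous_on_powr') auto
    fix x assume "x \<in> {s<..<u}"
    then have "((\<lambda>x. (x - w) powr p / p) has_real_derivative (x - w) powr (p - 1)) (at x)"
      using assms by (auto intro!: derivative_eq_intros simp: powr_diff field_simps)
    then show "((\<lambda>x. (x - w) powr p / p) has_vector_derivative (x - w) powr (p - 1)) (at x)"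
      by (simp add: has_real_derivative_iff_has_vector_derivative)
  qed
  then show ?thesis
    by (simp add: diff_divide_distrib)
qed

text \<open>Passes from a majorant with a known gauge integral to Bochner integrability and bounds.
  On the finite set \<open>N\<close>, where the estimate may fail, the absolute value of
  \<open>\<phi>\<close> itself serves as majorant, which leaves the integral unchanged.\<close>

lemma dominated_lebesgue_on:
  fixes \<phi> G :: "real \<Rightarrow> real"
  assumes "\<phi> \<in> borel_measurable (lebesgue_on S)" "S \<in> sets lebesgue"
    and "(G has_integral B) S" "finite N" "\<And>x. x \<in> S - N \<Longrightarrow> \<bar>\<phi> x\<bar> \<le> G x"
  shows "integrable (lebesgue_on S) \<phi>" "\<bar>LINT x|lebesgue_on S. \<phi> x\<bar> \<le> B"
    "(LINT x|lebesgue_on S. \<bar>\<phi> x\<bar>) \<le> B"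
proof -
  define G' where "G' x = (if x \<in> N then \<bar>\<phi> x\<bar> else G x)" for x
  have G': "(G' has_integral B) S"
    by (rule has_integral_spike_finite[OF \<open>finite N\<close> _ assms(3)]) (simp add: G'_def)
  have le: "\<bar>\<phi> x\<bar> \<le> G' x" if "x \<in> S" for x
    using assms(5)[of x] that by (auto simp: G'_def)
  show int: "integrable (lebesgue_on S) \<phi>"
    using measurable_bounded_by_integrable_imp_absolutely_integrable[OF assms(1,2), of G'] G' le
      absolutely_integrable_imp_integrable[OF _ assms(2)] by (auto simp: has_integral_integrable)
  then have abs: "integrable (lebesgue_on S) (\<lambda>x. \<bar>\<phi> x\<bar>)"
    by auto
  have "integral S (\<lambda>x. \<bar>\<phi> x\<bar>) \<le> B"
    using integrable_on_lebesgue_on[OF abs assms(2)] G' le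
    by (intro has_integral_le[OF integrable_integral]) auto
  then show *: "(LINT x|lebesgue_on S. \<bar>\<phi> x\<bar>) \<le> B"
    by (simp add: lebesgue_integral_eq_integral[OF abs assms(2)])
  show "\<bar>LINT x|lebesgue_on S. \<phi> x\<bar> \<le> B"
    using integral_abs_bound[of "lebesgue_on S" \<phi>] * by linarith
qed

text \<open>The inner integrals of the Weyl-Marchaud derivatives have a domain depending on
  \<open>x\<close>. Moving the domain into the integrand leaves a parameter integral over the fixed
  measure \<open>lborel\<close>, which is measurable in \<open>x\<close>.\<close>

lemma lebesgue_on_integral_eq_lborel:
  fixes \<phi> :: "real \<Rightarrow> real"
  assumes [measurable]: "\<phi> \<in> borel_measurable borel" "S \<in> sets borel"
  shows "(LINT y|lebesgue_on S. \<phi> y) = (LINT y|lborel. indicator S y * \<phi> y)"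
proof -
  have "(LINT y|lebesgue_on S. \<phi> y) = (LINT y|lebesgue. indicator S y *\<^sub>R \<phi> y)"
    by (subst integral_restrict_space) (auto simp: sets_completionI_sets)
  also have "\<dots> = (LINT y|lborel. indicator S y *\<^sub>R \<phi> y)"
    by (rule integral_completion) measurable
  finally show ?thesis
    by simp
qed

lemma borel_measurable_lebesgue_onI:
  fixes f :: "real \<Rightarrow> 'a::topological_space"
  assumes "f \<in> borel_measurable borel"
  shows "f \<in> borel_measurable (lebesgue_on S)"
  using assms by (intro measurable_restrict_space1 measurable_completion) simp

section \<open>The integral of a Hoelder function\<close>

text \<open>Continuation by the boundary values: for \<open>a \<le> b\<close> a function continuous
  on the interval becomes continuous, hence Borel, on the whole line.\<close>

definition clamp_ext :: "real \<Rightarrow> real \<Rightarrow> (real \<Rightarrow> real) \<Rightarrow> real \<Rightarrow> real" where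
  "clamp_ext a b f x = f (max a (min b x))"

lemma clamp_ext_eq: "x \<in> {a..b} \<Longrightarrow> clamp_ext a b f x = f x"
  by (auto simp: clamp_ext_def max_def min_def)

lemma continuous_clamp_ext:
  assumes "a \<le> b" "continuous_on {a..b} f"
  shows "continuous_on A (clamp_ext a b f)"
  unfolding clamp_ext_def
  by (rule continuous_on_compose2[OF assms(2)]) (use assms in \<open>auto intro!: continuous_intros\<close>)

lemma borel_clamp_ext:
  assumes "a \<le> b" "continuous_on {a..b} f"
  shows "clamp_ext a b f \<in> borel_measurable borel"
  by (rule borel_measurable_continuous_onI) (rule continuous_clamp_ext[OF assms])

lemma WM_left_indicator_measurable:
  assumes f[measurable]: "f \<in> borel_measurable borel"
  shows "WM_left \<alpha> a (\<lambda>x. indicator {c<..<d} x * f x) \<in> borel_measurable borel"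
proof -
  let ?h = "\<lambda>x. indicator {c<..<d} x * f x"
  have eq: "(LINT y|lebesgue_on {a<..<x}. (?h x - ?h y) / (x - y) powr (\<alpha> + 1)) =
      (LINT y|lborel. (if a < y \<and> y < x then (?h x - ?h y) / (x - y) powr (\<alpha> + 1) else 0))" for x
    by (subst lebesgue_on_integral_eq_lborel, measurable)
      (rule Bochner_Integration.integral_cong, auto simp: indicator_def)
  show ?thesis
    unfolding WM_left_def eq by measurable
qed

lemma WM_right_measurable:
  assumes f[measurable]: "f \<in> borel_measurable borel"
  shows "WM_right \<alpha> b f \<in> borel_measurable borel"
proof -
  have eq: "(LINT y|lebesgue_on {x<..<b}. (f x - f y) / (y - x) powr (\<alpha> + 1)) =
      (LINT y|lborel. (if x < y \<and> y < b then (f x - f y) / (y - x) powr (\<alpha> + 1) else 0))" for x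
    by (subst lebesgue_on_integral_eq_lborel, measurable)
      (rule Bochner_Integration.integral_cong, auto simp: indicator_def)
  show ?thesis
    unfolding WM_right_def eq by measurable
qed

section \<open>Left-sided derivatives of a truncated Hoelder function: pointwise and L1
  estimates\<close>

locale holder_integrand =
  fixes f :: "real \<Rightarrow> real" and T \<alpha> \<mu> F H :: real
  assumes T: "T > 0" and \<alpha>: "0 < \<alpha>" "\<alpha> < \<mu>" "\<alpha> < 1"
    and meas[measurable]: "f \<in> borel_measurable borel"
    and bound: "\<And>u. u \<in> {0..T} \<Longrightarrow> \<bar>f u\<bar> \<le> F"
    and holder: "\<And>u v. u \<in> {0..T} \<Longrightarrow> v \<in> {0..T} \<Longrightarrow> \<bar>f u - f v\<bar> \<le> H * \<bar>u - v\<bar> powr \<mu>"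
begin

abbreviation cut :: "real \<Rightarrow> real \<Rightarrow> real" where
  "cut t \<equiv> (\<lambda>x. indicator {0<..<t} x * f x)"

lemma F_nonneg: "F \<ge> 0"
  using bound[of 0] T by auto

lemma H_nonneg: "H \<ge> 0"
proof -
  have "0 \<le> H * T powr \<mu>"
    using holder[of 0 T] T by (auto intro: order_trans[OF abs_ge_zero])
  then show ?thesis
    using T by (simp add: zero_le_mult_iff)
qed

text \<open>On the positive axis \<open>d\<close> equals \<open>f\<close> on \<open>[s,t)\<close>
  and zero elsewhere. For \<open>s < x < t\<close> the sup bound \<open>F\<close> is used for
  \<open>y < s\<close>, where \<open>d y = 0\<close>, and the Hoelder bound for
  \<open>y \<ge> s\<close>; for \<open>x > t\<close> only \<open>y\<close> in \<open>[s,t)\<close>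
  contributes, again through \<open>F\<close>.\<close>

lemma inner_integral:
  assumes st: "0 \<le> s" "s \<le> t" "t \<le> T" and x: "x \<in> {0<..<T}" "x \<noteq> s" "x \<noteq> t"
  defines "d \<equiv> \<lambda>y. cut t y - cut s y"
  defines "\<phi> \<equiv> \<lambda>y. (d x - d y) / (x - y) powr (\<alpha> + 1)"
  defines "B \<equiv> (if x < s then 0
      else if x < t then F / \<alpha> * ((x - s) powr (-\<alpha>) - x powr (-\<alpha>)) + H / (\<mu> - \<alpha>) * (x - s) powr (\<mu> - \<alpha>)
      else F / \<alpha> * ((x - t) powr (-\<alpha>) - (x - s) powr (-\<alpha>)))"
  shows "integrable (lebesgue_on {0<..<x}) \<phi>" "\<bar>LINT y|lebesgue_on {0<..<x}. \<phi> y\<bar> \<le> B"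
proof -
  have d: "d y = (if s \<le> y \<and> y < t then f y else 0)" if "y > 0" for y
    using that st by (auto simp: d_def indicator_def)
  have meas: "\<phi> \<in> borel_measurable (lebesgue_on {0<..<x})"
    unfolding \<phi>_def d_def by (rule borel_measurable_lebesgue_onI) measurable
  have inv: "1 / (x - y) powr (\<alpha> + 1) = (x - y) powr (- \<alpha> - 1)" for y
    by (simp add: powr_minus_divide[of _ "\<alpha> + 1", symmetric])
  have "\<exists>G. (G has_integral B) {0<..<x} \<and> (\<forall>y\<in>{0<..<x}. \<bar>\<phi> y\<bar> \<le> G y)"
  proof -
    consider "x < s" | "s < x" "x < t" | "t < x" using x by linarith
    then show ?thesis
    proof cases
      case 1
      then have "\<phi> y = 0" if "y \<in> {0<..<x}" for y
        using that x by (simp add: \<phi>_def d)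
      then show ?thesis
        using 1 by (intro exI[of _ "\<lambda>_. 0"]) (auto simp: B_def)
    next
      case 2
      \<comment> \<open>Both closed pieces contain \<open>s\<close>; the overlap only enlarges the
        majorant at one point.\<close>
      define G where "G y = F / \<alpha> * (if y \<in> {0..s} then \<alpha> * (x - y) powr (-\<alpha>-1) else 0)
          + H * (if y \<in> {s..x} then (x - y) powr ((\<mu>-\<alpha>)-1) else 0)" for y
      have "((\<lambda>y. if y \<in> {0..s} then \<alpha> * (x - y) powr (-\<alpha>-1) else 0) has_integral
           ((x - s) powr (-\<alpha>) - (x - 0) powr (-\<alpha>))) {0..x}"
        using has_integral_singular_kernel[of 0 s x \<alpha>] 2 st \<alpha> by (subst has_integral_restrict) auto
      moreover have "((\<lambda>y. if y \<in> {s..x} then (x - y) powr ((\<mu>-\<alpha>)-1) else 0) has_integral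
           ((x - s) powr (\<mu>-\<alpha>) - (x - x) powr (\<mu>-\<alpha>)) / (\<mu>-\<alpha>)) {0..x}"
        using has_integral_left_kernel[of s x x "\<mu> - \<alpha>"] 2 st \<alpha> by (subst has_integral_restrict) auto
      ultimately have "(G has_integral (F / \<alpha> * ((x - s) powr (-\<alpha>) - (x - 0) powr (-\<alpha>)) +
           H * (((x - s) powr (\<mu>-\<alpha>) - (x - x) powr (\<mu>-\<alpha>)) / (\<mu>-\<alpha>)))) {0..x}"
        unfolding G_def by (intro has_integral_add has_integral_mult_right)
      moreover have "F / \<alpha> * ((x - s) powr (-\<alpha>) - (x - 0) powr (-\<alpha>)) +
           H * (((x - s) powr (\<mu>-\<alpha>) - (x - x) powr (\<mu>-\<alpha>)) / (\<mu>-\<alpha>)) = B"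
        using 2 \<alpha> by (simp add: B_def)
      ultimately have "(G has_integral B) {0<..<x}"
        by (simp add: has_integral_Icc_iff_Ioo)
      moreover have "\<bar>\<phi> y\<bar> \<le> G y" if y: "y \<in> {0<..<x}" for y
      proof (cases "y < s")
        case True
        then have "\<bar>\<phi> y\<bar> = \<bar>f x\<bar> * (x - y) powr (- \<alpha> - 1)"
          using 2 y x by (simp add: \<phi>_def d inv[symmetric] abs_mult)
        also have "\<dots> \<le> F * (x - y) powr (- \<alpha> - 1)"
          using bound[of x] x by (intro mult_right_mono) auto
        finally show ?thesis
          using True y \<alpha> by (simp add: G_def)
      next
        case False
        then have "\<bar>\<phi> y\<bar> = \<bar>f x - f y\<bar> * (x - y) powr (- \<alpha> - 1)"
          using 2 y x by (simp add: \<phi>_def d inv[symmetric] abs_mult)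
        also have "\<dots> \<le> (H * \<bar>x - y\<bar> powr \<mu>) * (x - y) powr (- \<alpha> - 1)"
          using holder[of x y] x y by (intro mult_right_mono) auto
        also have "\<dots> = H * (x - y) powr ((\<mu> - \<alpha>) - 1)"
          using y by (simp add: powr_add[symmetric] algebra_simps)
        also have "\<dots> \<le> G y"
          using False y \<alpha> F_nonneg by (simp add: G_def)
        finally show ?thesis .
      qed
      ultimately show ?thesis by blast
    next
      case 3
      define G where "G y = F / \<alpha> * (if y \<in> {s..t} then \<alpha> * (x - y) powr (-\<alpha>-1) else 0)" for y
      have "((\<lambda>y. if y \<in> {s..t} then \<alpha> * (x - y) powr (-\<alpha>-1) else 0) has_integral
           ((x - t) powr (-\<alpha>) - (x - s) powr (-\<alpha>))) {0..x}"
        using 3 st \<alpha> by (subst has_integral_restrict) (auto intro!: has_integral_singular_kernel)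
      then have "(G has_integral F / \<alpha> * ((x - t) powr (-\<alpha>) - (x - s) powr (-\<alpha>))) {0..x}"
        unfolding G_def by (intro has_integral_mult_right)
      then have "(G has_integral B) {0<..<x}"
        using 3 st by (simp add: has_integral_Icc_iff_Ioo B_def)
      moreover have "\<bar>\<phi> y\<bar> \<le> G y" if y: "y \<in> {0<..<x}" for y
      proof (cases "s \<le> y \<and> y < t")
        case True
        then have "\<bar>\<phi> y\<bar> = \<bar>f y\<bar> * (x - y) powr (- \<alpha> - 1)"
          using 3 y x by (simp add: \<phi>_def d inv[symmetric] abs_mult)
        also have "\<dots> \<le> F * (x - y) powr (- \<alpha> - 1)"
          using bound[of y] x y by (intro mult_right_mono) auto
        finally show ?thesis
          using True y \<alpha> by (simp add: G_def)
      next
        case False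
        then have "\<phi> y = 0"
          using 3 y x by (auto simp: \<phi>_def d)
        then show ?thesis
          using F_nonneg \<alpha> by (simp add: G_def)
      qed
      ultimately show ?thesis by blast
    qed
  qed
  then obtain G where G: "(G has_integral B) {0<..<x}" "\<And>y. y \<in> {0<..<x} \<Longrightarrow> \<bar>\<phi> y\<bar> \<le> G y"
    by blast
  show "integrable (lebesgue_on {0<..<x}) \<phi>" "\<bar>LINT y|lebesgue_on {0<..<x}. \<phi> y\<bar> \<le> B"
    by (rule dominated_lebesgue_on[OF meas _ G(1) finite.emptyI]; use G(2) in simp)+
qed

text \<open>On \<open>(s,t)\<close> the boundary term \<open>f x / x powr \<alpha>\<close> and the part of the inner integral over \<open>(0,s)\<close>
  add up to at most \<open>F * (x - s) powr (- \<alpha>)\<close>; on \<open>(t,T)\<close> only the inner integral over \<open>(s,t)\<close>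
  survives. The exponent is written \<open>(1 - \<alpha>) - 1\<close> to match the kernel integrals.\<close>

definition envelope :: "real \<Rightarrow> real \<Rightarrow> real \<Rightarrow> real" where
  "envelope s t x = (F + \<alpha> * H / (\<mu> - \<alpha>) * T powr \<mu>) * (if x \<in> {s..t} then (x - s) powr ((1 - \<alpha>) - 1) else 0)
     + F * (if x \<in> {t..T} then (x - t) powr ((1 - \<alpha>) - 1) - (x - s) powr ((1 - \<alpha>) - 1) else 0)"

text \<open>The constant from integrating \<open>envelope\<close>: the part over
  \<open>(s,t)\<close> gives its coefficient, the tail over \<open>(t,T)\<close> a further
  \<open>F\<close>, each divided by \<open>1 - \<alpha>\<close>.\<close>

definition sub_const :: real where
  "sub_const = \<bar>1 / Gamma (1 - \<alpha>)\<bar> * ((2 * F + \<alpha> * H / (\<mu> - \<alpha>) * T powr \<mu>) / (1 - \<alpha>))"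

lemma WM_left_cut_diff:
  assumes st: "0 \<le> s" "s \<le> t" "t \<le> T" and x: "x \<in> {0<..<T}" "x \<noteq> s" "x \<noteq> t"
  shows "\<bar>WM_left \<alpha> 0 (cut t) x - WM_left \<alpha> 0 (cut s) x\<bar> \<le> \<bar>1 / Gamma (1 - \<alpha>)\<bar> * envelope s t x"
proof -
  let ?M = "lebesgue_on {0<..<x}"
  define q where "q h y = (h x - h y) / (x - y) powr (\<alpha> + 1)" for h :: "real \<Rightarrow> real" and y
  define d where "d y = cut t y - cut s y" for y
  \<comment> \<open>Taking \<open>s = 0\<close> in \<open>inner_integral\<close> covers a single
    truncation, because \<open>cut 0\<close> vanishes. Integrability of both quotients then allows
    the integral of the difference to be split.\<close>
  have int: "integrable ?M (q (cut u))" if "u = s \<or> u = t" for u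
    using inner_integral(1)[of 0 u x] that st x by (auto simp: q_def[abs_def])
  have "q d y = q (cut t) y - q (cut s) y" for y
    by (simp add: q_def d_def diff_divide_distrib)
  then have qd: "(LINT y|?M. q d y) = (LINT y|?M. q (cut t) y) - (LINT y|?M. q (cut s) y)"
    using int by simp
  have eq: "WM_left \<alpha> 0 (cut t) x - WM_left \<alpha> 0 (cut s) x
      = 1 / Gamma (1 - \<alpha>) * (d x / x powr \<alpha> + \<alpha> * (LINT y|?M. q d y))"
    unfolding WM_left_def qd unfolding q_def d_def by (simp add: algebra_simps diff_divide_distrib)
  have dx: "d x = (if s \<le> x \<and> x < t then f x else 0)"
    using x st by (auto simp: d_def indicator_def)
  define I where "I = (LINT y|?M. q d y)"
  have I: "\<bar>I\<bar> \<le> (if x < s then 0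
      else if x < t then F / \<alpha> * ((x - s) powr (-\<alpha>) - x powr (-\<alpha>)) + H / (\<mu> - \<alpha>) * (x - s) powr (\<mu> - \<alpha>)
      else F / \<alpha> * ((x - t) powr (-\<alpha>) - (x - s) powr (-\<alpha>)))"
    using inner_integral(2)[OF st x] unfolding I_def q_def d_def .
  have tri: "\<bar>d x / x powr \<alpha> + \<alpha> * I\<bar> \<le> \<bar>d x\<bar> * x powr (-\<alpha>) + \<alpha> * \<bar>I\<bar>"
    using \<alpha> x by (intro abs_triangle_ineq[THEN order_trans]) (simp add: abs_mult powr_minus_divide)
  have "\<bar>d x / x powr \<alpha> + \<alpha> * I\<bar> \<le> envelope s t x"
  proof -
    consider "x < s" | "s < x" "x < t" | "t < x" using x by linarith
    then show ?thesis
    proof cases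
      case 1
      then show ?thesis using I dx st by (auto simp: envelope_def)
    next
      case 2
      have "\<bar>d x\<bar> * x powr (-\<alpha>) + \<alpha> * \<bar>I\<bar> \<le> F * x powr (-\<alpha>) +
          \<alpha> * (F / \<alpha> * ((x - s) powr (-\<alpha>) - x powr (-\<alpha>)) + H / (\<mu> - \<alpha>) * (x - s) powr (\<mu> - \<alpha>))"
        using I 2 dx bound[of x] x \<alpha> by (intro add_mono mult_right_mono mult_left_mono) auto
      also have "\<dots> = F * (x - s) powr (-\<alpha>) + \<alpha> * H / (\<mu> - \<alpha>) * (x - s) powr (\<mu> - \<alpha>)"
        using \<alpha> by (simp add: field_simps)
      also have "(x - s) powr (\<mu> - \<alpha>) = (x - s) powr \<mu> * (x - s) powr (-\<alpha>)"
        by (simp add: powr_add[symmetric])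
      \<comment> \<open>The surplus factor \<open>(x - s) powr \<mu>\<close> is replaced by the
        constant \<open>T powr \<mu>\<close>, so that one kernel carries both terms.\<close>
      also have "F * (x - s) powr (-\<alpha>) + \<alpha> * H / (\<mu> - \<alpha>) * ((x - s) powr \<mu> * (x - s) powr (-\<alpha>))
          \<le> F * (x - s) powr (-\<alpha>) + \<alpha> * H / (\<mu> - \<alpha>) * (T powr \<mu> * (x - s) powr (-\<alpha>))"
        using 2 st \<alpha> H_nonneg by (intro add_left_mono mult_left_mono mult_right_mono powr_mono2) auto
      also have "\<dots> = envelope s t x"
        using 2 by (simp add: envelope_def algebra_simps)
      finally show ?thesis using tri by linarith
    next
      case 3
      have "\<alpha> * \<bar>I\<bar> \<le> \<alpha> * (F / \<alpha> * ((x - t) powr (-\<alpha>) - (x - s) powr (-\<alpha>)))"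
        using I 3 st \<alpha> by (intro mult_left_mono) auto
      also have "\<dots> = envelope s t x"
        using 3 x \<alpha> by (simp add: envelope_def algebra_simps)
      finally show ?thesis using tri dx 3 by simp
    qed
  qed
  then show ?thesis
    unfolding eq I_def[symmetric] abs_mult by (rule mult_left_mono) simp
qed

lemma WM_left_cut_0: "WM_left \<alpha> 0 (cut 0) x = 0"
  by (simp add: WM_left_def)

text \<open>Over \<open>(s,t)\<close> the kernel integrates directly to a multiple of
  \<open>(t - s) powr (1 - \<alpha>)\<close>. In the tail the contributions at the endpoint
  \<open>T\<close> have a nonpositive difference, since \<open>T - t \<le> T - s\<close>, and what
  is left is again of order \<open>(t - s) powr (1 - \<alpha>)\<close>.\<close>

lemma integral_envelope:
  assumes st: "0 \<le> s" "s \<le> t" "t \<le> T"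
  shows "\<exists>B. ((\<lambda>x. \<bar>1 / Gamma (1 - \<alpha>)\<bar> * envelope s t x) has_integral B) {0<..<T} \<and>
     B \<le> sub_const * (t - s) powr (1 - \<alpha>)"
proof -
  define C where "C = F + \<alpha> * H / (\<mu> - \<alpha>) * T powr \<mu>"
  define p where "p = 1 - \<alpha>"
  have p: "p > 0" using \<alpha> by (simp add: p_def)
  have k1: "((\<lambda>x. if x \<in> {s..t} then (x - s) powr (p - 1) else 0) has_integral
      ((t - s) powr p - (s - s) powr p) / p) {0..T}"
    using has_integral_right_kernel[of s s t p] st p by (subst has_integral_restrict) auto
  have k2: "((\<lambda>x. if x \<in> {t..T} then (x - t) powr (p - 1) - (x - s) powr (p - 1) else 0) has_integral
      (((T - t) powr p - (t - t) powr p) / p - ((T - s) powr p - (t - s) powr p) / p)) {0..T}"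
    using has_integral_diff[OF has_integral_right_kernel[of t t T p] has_integral_right_kernel[of s t T p]] st p
    by (subst has_integral_restrict) auto
  define B where "B = \<bar>1 / Gamma (1 - \<alpha>)\<bar> * (C * (((t - s) powr p - (s - s) powr p) / p)
     + F * (((T - t) powr p - (t - t) powr p) / p - ((T - s) powr p - (t - s) powr p) / p))"
  have "((\<lambda>x. \<bar>1 / Gamma (1 - \<alpha>)\<bar> * envelope s t x) has_integral B) {0..T}"
    unfolding envelope_def C_def[symmetric] p_def[symmetric] B_def
    by (intro has_integral_mult_right has_integral_add k1 k2)
  moreover have "B \<le> sub_const * (t - s) powr (1 - \<alpha>)"
  proof -
    have "(T - t) powr p \<le> (T - s) powr p"
      using st p by (intro powr_mono2) auto
    then have tail: "((T - t) powr p - (t - t) powr p) / p - ((T - s) powr p - (t - s) powr p) / p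
        \<le> (t - s) powr p / p"
      using p by (simp add: divide_simps)
    then have "C * (((t - s) powr p - (s - s) powr p) / p)
     + F * (((T - t) powr p - (t - t) powr p) / p - ((T - s) powr p - (t - s) powr p) / p)
      \<le> C * ((t - s) powr p / p) + F * ((t - s) powr p / p)"
      using mult_left_mono[OF tail F_nonneg] by simp
    also have "\<dots> = (C + F) / p * (t - s) powr p"
      by (simp add: add_divide_distrib algebra_simps)
    finally have "B \<le> \<bar>1 / Gamma (1 - \<alpha>)\<bar> * ((C + F) / p * (t - s) powr p)"
      unfolding B_def by (rule mult_left_mono) simp
    then show ?thesis
      by (simp add: sub_const_def C_def p_def add.commute mult.assoc)
  qed
  ultimately show ?thesis
    by (auto simp: has_integral_Icc_iff_Ioo)
qed

lemma WM_left_cut_measurable: "WM_left \<alpha> 0 (cut t) \<in> borel_measurable (lebesgue_on S)"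
  by (intro borel_measurable_lebesgue_onI WM_left_indicator_measurable meas)

lemma WM_left_cut_diff_integral:
  assumes st: "0 \<le> s" "s \<le> t" "t \<le> T"
  shows "integrable (lebesgue_on {0<..<T}) (\<lambda>x. WM_left \<alpha> 0 (cut t) x - WM_left \<alpha> 0 (cut s) x)"
    and "(LINT x|lebesgue_on {0<..<T}. \<bar>WM_left \<alpha> 0 (cut t) x - WM_left \<alpha> 0 (cut s) x\<bar>)
      \<le> sub_const * (t - s) powr (1 - \<alpha>)"
proof -
  from integral_envelope[OF st] obtain B where
    B: "((\<lambda>x. \<bar>1 / Gamma (1 - \<alpha>)\<bar> * envelope s t x) has_integral B) {0<..<T}"
    and le: "B \<le> sub_const * (t - s) powr (1 - \<alpha>)"
    by blast
  have m: "(\<lambda>x. WM_left \<alpha> 0 (cut t) x - WM_left \<alpha> 0 (cut s) x) \<in> borel_measurable (lebesgue_on {0<..<T})"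
    by (intro borel_measurable_diff WM_left_cut_measurable)
  \<comment> \<open>The pointwise estimate excludes \<open>x = s\<close> and \<open>x = t\<close>;
    these form the finite exceptional set.\<close>
  note D = dominated_lebesgue_on[OF m _ B, of "{s, t}"]
  show "integrable (lebesgue_on {0<..<T}) (\<lambda>x. WM_left \<alpha> 0 (cut t) x - WM_left \<alpha> 0 (cut s) x)"
    by (rule D(1)) (use WM_left_cut_diff[OF st] in auto)
  have "(LINT x|lebesgue_on {0<..<T}. \<bar>WM_left \<alpha> 0 (cut t) x - WM_left \<alpha> 0 (cut s) x\<bar>) \<le> B"
    by (rule D(3)) (use WM_left_cut_diff[OF st] in auto)
  with le show "(LINT x|lebesgue_on {0<..<T}. \<bar>WM_left \<alpha> 0 (cut t) x - WM_left \<alpha> 0 (cut s) x\<bar>)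
      \<le> sub_const * (t - s) powr (1 - \<alpha>)"
    by linarith
qed

text \<open>The derivative of \<open>cut 0\<close> is zero, so the difference estimate with
  \<open>s = 0\<close> is an estimate for a single truncation.\<close>

lemma WM_left_cut_integrable:
  "t \<in> {0..T} \<Longrightarrow> integrable (lebesgue_on {0<..<T}) (WM_left \<alpha> 0 (cut t))"
  using WM_left_cut_diff_integral(1)[of 0 t] unfolding WM_left_cut_0 by simp

lemma WM_left_cut_exists:
  assumes "t \<in> {0..T}"
  shows "WM_left_exists \<alpha> 0 T (cut t)"
proof -
  \<comment> \<open>At \<open>x = t\<close> the truncated function may jump and the inner integral
    diverge; one point is negligible.\<close>
  have "AE x in lebesgue. x \<notin> {t}"
    by (rule AE_not_in) simp
  then have "AE x in lebesgue_on {0<..<T}. x \<noteq> t"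
    by (subst AE_restrict_space_iff) auto
  then show ?thesis
    unfolding WM_left_exists_def
  proof (rule AE_mp, intro AE_I2 impI)
    fix x assume "x \<in> space (lebesgue_on {0<..<T})" "x \<noteq> t"
    then show "integrable (lebesgue_on {0<..<x}) (\<lambda>y. (cut t x - cut t y) / (x - y) powr (\<alpha> + 1))"
      using inner_integral(1)[of 0 t x] assms by simp
  qed
qed

end

section \<open>The integrator: boundedness of its right-sided derivative\<close>

lemma W_space_bounds:
  assumes "g \<in> W_space \<alpha> T"
  shows "\<exists>\<Lambda>\<ge>0. \<forall>u v. 0 \<le> u \<and> u < v \<and> v \<le> T \<longrightarrow>
    \<bar>g v - g u\<bar> \<le> \<Lambda> * (v - u) powr (1 - \<alpha>) \<and>
    (\<integral>\<^sup>+ y. ennreal (\<bar>g y - g u\<bar> / (y - u) powr (2 - \<alpha>)) \<partial>lebesgue_on {u<..<v}) \<le> ennreal \<Lambda>"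
proof -
  define q where "q u v = ennreal (\<bar>g v - g u\<bar> / (v - u) powr (1 - \<alpha>))" for u v
  define I where "I u v = (\<integral>\<^sup>+ y. ennreal (\<bar>g y - g u\<bar> / (y - u) powr (2 - \<alpha>)) \<partial>lebesgue_on {u<..<v})" for u v
  define S where "S = (SUP (u, v) \<in> {(u, v). 0 \<le> u \<and> u < v \<and> v \<le> T}. q u v + I u v)"
  have "S < \<infinity>"
    using assms by (simp add: W_space_def S_def q_def I_def)
  then obtain \<Lambda> where \<Lambda>: "\<Lambda> \<ge> 0" "S = ennreal \<Lambda>"
    by (cases S) auto
  have le: "q u v + I u v \<le> ennreal \<Lambda>" if "0 \<le> u" "u < v" "v \<le> T" for u v
    unfolding \<Lambda>(2)[symmetric] S_def using that by (intro SUP_upper2[of "(u, v)"]) auto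
  show ?thesis
  proof (intro exI[of _ \<Lambda>] conjI allI impI \<Lambda>(1); elim conjE)
    fix u v :: real assume uv: "0 \<le> u" "u < v" "v \<le> T"
    have "q u v \<le> ennreal \<Lambda>"
      using le[OF uv] by (meson order_trans add_increasing2 le_add_same_cancel1 zero_le order_refl)
    then have "\<bar>g v - g u\<bar> / (v - u) powr (1 - \<alpha>) \<le> \<Lambda>"
      using \<Lambda>(1) by (simp add: q_def)
    then show "\<bar>g v - g u\<bar> \<le> \<Lambda> * (v - u) powr (1 - \<alpha>)"
      using uv by (simp add: divide_le_eq)
  next
    fix u v :: real assume uv: "0 \<le> u" "u < v" "v \<le> T"
    show "(\<integral>\<^sup>+ y. ennreal (\<bar>g y - g u\<bar> / (y - u) powr (2 - \<alpha>)) \<partial>lebesgue_on {u<..<v}) \<le> ennreal \<Lambda>"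
      using le[OF uv] unfolding I_def[symmetric]
      by (meson order_trans add_increasing le_add_same_cancel2 zero_le order_refl)
  qed
qed

lemma holder_on_imp_continuous_on:
  assumes "\<mu> > 0" "holder_on \<mu> S f"
  shows "continuous_on S f"
proof -
  from assms(2) obtain C where C: "\<And>s t. s \<in> S \<Longrightarrow> t \<in> S \<Longrightarrow> \<bar>f t - f s\<bar> \<le> C * \<bar>t - s\<bar> powr \<mu>"
    unfolding holder_on_def by blast
  show ?thesis
    unfolding continuous_on_def
  proof
    fix s assume s: "s \<in> S"
    have "((\<lambda>t. C * \<bar>t - s\<bar> powr \<mu>) \<longlongrightarrow> C * \<bar>s - s\<bar> powr \<mu>) (at s within S)"
      using assms(1) by (intro tendsto_intros tendsto_powr') auto
    then have "((\<lambda>t. C * \<bar>t - s\<bar> powr \<mu>) \<longlongrightarrow> 0) (at s within S)"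
      by simp
    then have "((\<lambda>t. f t - f s) \<longlongrightarrow> 0) (at s within S)"
      by (rule Lim_null_comparison[rotated])
        (use C[OF s] in \<open>auto simp: eventually_at_filter\<close>)
    then show "(f \<longlongrightarrow> f s) (at s within S)"
      by (simp add: LIM_zero_iff)
  qed
qed

text \<open>Continuity identifies the left limit at \<open>T\<close> with \<open>g T\<close> and
  permits replacing the integrator by a Borel function on the line.\<close>

lemma W_space_continuous:
  assumes "\<alpha> < 1" "g \<in> W_space \<alpha> T"
  shows "continuous_on {0..T} g"
proof -
  obtain \<Lambda> where L: "\<And>u v. 0 \<le> u \<Longrightarrow> u < v \<Longrightarrow> v \<le> T \<Longrightarrow> \<bar>g v - g u\<bar> \<le> \<Lambda> * (v - u) powr (1 - \<alpha>)"
    using W_space_bounds[OF assms(2)] by auto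
  have "\<bar>g t - g s\<bar> \<le> \<Lambda> * \<bar>t - s\<bar> powr (1 - \<alpha>)" if "s \<in> {0..T}" "t \<in> {0..T}" for s t
    using L[of s t] L[of t s] that by (cases s t rule: linorder_cases) (auto simp: abs_minus_commute)
  then have "holder_on (1 - \<alpha>) {0..T} g"
    unfolding holder_on_def by blast
  then show ?thesis
    using assms(1) by (intro holder_on_imp_continuous_on) auto
qed

text \<open>The two terms of the norm of \<open>W_space\<close> match the two terms of the
  derivative: the increment quotient bounds the boundary term, and the integral with
  \<open>u = x\<close>, \<open>v = T\<close> bounds the inner integral. Subtracting the left limit
  does not affect differences.\<close>

lemma WM_right_integrator:
  assumes T: "T > 0" and \<alpha>: "0 < \<alpha>" "\<alpha> < 1" and g: "g \<in> W_space \<alpha> T"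
  shows "\<exists>l. (g \<longlongrightarrow> l) (at_left T)"
    and "WM_right_exists (1 - \<alpha>) 0 T (minus_left_limit g T)"
    and "WM_right (1 - \<alpha>) T (minus_left_limit g T) \<in> borel_measurable (lebesgue_on {0<..<T})"
    and "\<exists>M\<ge>0. \<forall>x\<in>{0<..<T}. norm (WM_right (1 - \<alpha>) T (minus_left_limit g T) x) \<le> M"
proof -
  obtain \<Lambda> where L0: "\<Lambda> \<ge> 0"
    and L: "\<And>u v. 0 \<le> u \<Longrightarrow> u < v \<Longrightarrow> v \<le> T \<Longrightarrow> \<bar>g v - g u\<bar> \<le> \<Lambda> * (v - u) powr (1 - \<alpha>)"
    and LI: "\<And>u v. 0 \<le> u \<Longrightarrow> u < v \<Longrightarrow> v \<le> T \<Longrightarrow>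
      (\<integral>\<^sup>+ y. ennreal (\<bar>g y - g u\<bar> / (y - u) powr (2 - \<alpha>)) \<partial>lebesgue_on {u<..<v}) \<le> ennreal \<Lambda>"
    using W_space_bounds[OF g] by auto
  have cont: "continuous_on {0..T} g"
    by (rule W_space_continuous[OF \<alpha>(2) g])
  have "(g \<longlongrightarrow> g T) (at T within {0..T})"
    using cont T by (simp add: continuous_on_def)
  then have lim: "(g \<longlongrightarrow> g T) (at_left T)"
    using T by (simp add: at_within_Icc_at_left)
  then show "\<exists>l. (g \<longlongrightarrow> l) (at_left T)" by blast
  define m where "m = minus_left_limit g T"
  have m: "m = (\<lambda>x. g x - g T)"
    using tendsto_Lim[OF _ lim] by (auto simp: m_def minus_left_limit_def)
  \<comment> \<open>The extension makes the general measurability lemma applicable; the derivative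
    on \<open>(0,T)\<close> only sees values on \<open>[0,T]\<close>.\<close>
  define m' where "m' = clamp_ext 0 T m"
  have m'[measurable]: "m' \<in> borel_measurable borel"
    unfolding m'_def m using T by (intro borel_clamp_ext continuous_intros cont) auto
  have m'_eq: "m' x = m x" if "x \<in> {0..T}" for x
    using clamp_ext_eq[OF that] by (simp add: m'_def)
  define q where "q h x y = (h x - h y) / (y - x) powr (1 - \<alpha> + 1)" for h :: "real \<Rightarrow> real" and x y
  have q_eq: "q m x y = q m' x y" if "x \<in> {0<..<T}" "y \<in> {x<..<T}" for x y
    using that by (simp add: q_def m'_eq)
  have nn: "(\<integral>\<^sup>+ y. ennreal (norm (q m' x y)) \<partial>lebesgue_on {x<..<T}) \<le> ennreal \<Lambda>" if x: "x \<in> {0<..<T}" for x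
  proof -
    have "(\<integral>\<^sup>+ y. ennreal (norm (q m' x y)) \<partial>lebesgue_on {x<..<T})
        = (\<integral>\<^sup>+ y. ennreal (\<bar>g y - g x\<bar> / (y - x) powr (2 - \<alpha>)) \<partial>lebesgue_on {x<..<T})"
      using x by (intro nn_integral_cong) (auto simp: q_def m'_eq m abs_minus_commute)
    also have "\<dots> \<le> ennreal \<Lambda>"
      using LI[of x T] x by simp
    finally show ?thesis .
  qed
  have int': "integrable (lebesgue_on {x<..<T}) (q m' x)" if x: "x \<in> {0<..<T}" for x
  proof (rule integrableI_bounded)
    show "q m' x \<in> borel_measurable (lebesgue_on {x<..<T})"
      unfolding q_def by (rule borel_measurable_lebesgue_onI) measurable
    show "(\<integral>\<^sup>+ y. ennreal (norm (q m' x y)) \<partial>lebesgue_on {x<..<T}) < \<infinity>"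
      using nn[OF x] by (rule order_le_less_trans) simp
  qed
  have "integrable (lebesgue_on {x<..<T}) (q m x)" if x: "x \<in> {0<..<T}" for x
    using int'[OF x] by (rule Bochner_Integration.integrable_cong[THEN iffD1, rotated 2])
      (use q_eq[OF x] in auto)
  then show "WM_right_exists (1 - \<alpha>) 0 T (minus_left_limit g T)"
    unfolding WM_right_exists_def m_def[symmetric] q_def by (intro AE_I2) simp
  have WM_eq: "WM_right (1 - \<alpha>) T m x = WM_right (1 - \<alpha>) T m' x" if x: "x \<in> {0<..<T}" for x
  proof -
    have "(LINT y|lebesgue_on {x<..<T}. q m x y) = (LINT y|lebesgue_on {x<..<T}. q m' x y)"
      by (rule Bochner_Integration.integral_cong) (use q_eq[OF x] in auto)
    then show ?thesis
      using x m'_eq[of x] by (simp add: WM_right_def q_def)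
  qed
  have "WM_right (1 - \<alpha>) T m' \<in> borel_measurable (lebesgue_on {0<..<T})"
    by (intro borel_measurable_lebesgue_onI WM_right_measurable m')
  then show "WM_right (1 - \<alpha>) T (minus_left_limit g T) \<in> borel_measurable (lebesgue_on {0<..<T})"
    unfolding m_def[symmetric] by (rule measurable_cong[THEN iffD2, rotated]) (simp add: WM_eq)
  define c where "c = norm ((-1) powr complex_of_real (1 - \<alpha>) / complex_of_real (Gamma (1 - (1 - \<alpha>))))"
  have "norm (WM_right (1 - \<alpha>) T m x) \<le> c * (\<Lambda> + (1 - \<alpha>) * \<Lambda>)" if x: "x \<in> {0<..<T}" for x
  proof -
    define I where "I = (LINT y|lebesgue_on {x<..<T}. q m' x y)"
    have "ennreal \<bar>I\<bar> \<le> ennreal \<Lambda>"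
      using integral_norm_bound_ennreal[OF int'[OF x]] nn[OF x] unfolding I_def by simp
    then have I: "\<bar>I\<bar> \<le> \<Lambda>"
      using L0 by simp
    have "\<bar>m' x / (T - x) powr (1 - \<alpha>)\<bar> \<le> \<Lambda>"
      using L[of x T] x m'_eq[of x] by (simp add: m abs_divide abs_minus_commute divide_le_eq)
    then have "\<bar>m' x / (T - x) powr (1 - \<alpha>) + (1 - \<alpha>) * I\<bar> \<le> \<Lambda> + (1 - \<alpha>) * \<Lambda>"
      using I \<alpha> by (intro abs_triangle_ineq[THEN order_trans] add_mono) (auto simp: abs_mult)
    then show ?thesis
      unfolding WM_eq[OF x] unfolding WM_right_def I_def[unfolded q_def, symmetric] norm_mult norm_of_real c_def
      by (rule mult_left_mono) simp
  qed
  then show "\<exists>M\<ge>0. \<forall>x\<in>{0<..<T}. norm (WM_right (1 - \<alpha>) T (minus_left_limit g T) x) \<le> M"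
    unfolding m_def[symmetric] using L0 \<alpha>
    by (intro exI[of _ "c * (\<Lambda> + (1 - \<alpha>) * \<Lambda>)"]) (auto simp: c_def)
qed

text \<open>Every integral is taken over the base interval \<open>[0,T]\<close> with a truncated
  integrand, so the right-sided derivative is the same for all \<open>t\<close>. An increment in
  \<open>t\<close> thus pairs the difference of two left-sided derivatives, small in L1, with one
  bounded function.\<close>

proposition GLS_sub_holder:
  assumes T: "T > 0" and \<alpha>: "0 < \<alpha>" "\<alpha> < \<mu>" "\<alpha> < 1"
    and f: "holder_on \<mu> {0..T} f" and g: "g \<in> W_space \<alpha> T"
  shows "\<forall>t\<in>{0..T}. GLS_sub_defined \<alpha> 0 T 0 t f g"
    and "holder_on (1 - \<alpha>) {0..T} (\<lambda>t. GLS_sub_integral \<alpha> 0 T 0 t f g)"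
proof -
  from f obtain C where C: "\<And>s t. s \<in> {0..T} \<Longrightarrow> t \<in> {0..T} \<Longrightarrow> \<bar>f t - f s\<bar> \<le> C * \<bar>t - s\<bar> powr \<mu>"
    unfolding holder_on_def by blast
  have cont: "continuous_on {0..T} f"
    using \<alpha> f by (intro holder_on_imp_continuous_on[of \<mu>]) auto
  have "\<exists>F. \<forall>u\<in>{0..T}. \<bar>f u\<bar> \<le> F"
    using compact_imp_bounded[OF compact_continuous_image[OF cont compact_Icc]]
    by (auto simp: bounded_iff)
  then obtain F where F: "\<And>u. u \<in> {0..T} \<Longrightarrow> \<bar>f u\<bar> \<le> F"
    by blast
  define f' where "f' = clamp_ext 0 T f"
  have f': "f' u = f u" if "u \<in> {0..T}" for u
    using clamp_ext_eq[OF that] by (simp add: f'_def)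
  interpret holder_integrand f' T \<alpha> \<mu> F C
    using T \<alpha> borel_clamp_ext[OF _ cont] F C by unfold_locales (auto simp: f' f'_def[symmetric])
  \<comment> \<open>Truncation at \<open>t \<le> T\<close> hides the extension, so the integrals of
    \<open>f\<close> and \<open>f'\<close> coincide.\<close>
  have cut: "(\<lambda>s. indicator {0<..<t} s * f s) = cut t" if "t \<in> {0..T}" for t
    using that f' by (auto simp: indicator_def)
  note R = WM_right_integrator[OF T \<alpha>(1,3) g]
  let ?N = "lebesgue_on {0<..<T}"
  let ?R = "WM_right (1 - \<alpha>) T (minus_left_limit g T)"
  from R(4) obtain M where M: "M \<ge> 0" "\<And>x. x \<in> {0<..<T} \<Longrightarrow> norm (?R x) \<le> M"
    by blast
  show "\<forall>t\<in>{0..T}. GLS_sub_defined \<alpha> 0 T 0 t f g"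
  proof
    fix t assume t: "t \<in> {0..T}"
    show "GLS_sub_defined \<alpha> 0 T 0 t f g"
      unfolding GLS_sub_defined_def GLS_defined_def cut[OF t]
    proof (intro conjI)
      show "\<exists>M. AE x in ?N. norm (?R x) \<le> M"
        by (intro exI[of _ M] AE_I2) (simp add: M(2))
    qed (fact WM_left_cut_exists[OF t] WM_left_cut_integrable[OF t] R(1-3))+
  qed
  define c where "c = (-1) powr complex_of_real \<alpha>"
  define D where "D t x = WM_left \<alpha> 0 (cut t) x" for t x
  \<comment> \<open>The pairing of L1 with L-infinity, giving existence of the integral as well as
    its bound.\<close>
  have prod_bound: "integrable ?N (\<lambda>x. complex_of_real (\<phi> x) * ?R x) \<and>
      norm (LINT x|?N. complex_of_real (\<phi> x) * ?R x) \<le> M * (LINT x|?N. \<bar>\<phi> x\<bar>)"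
    if \<phi>: "integrable ?N \<phi>" for \<phi>
  proof -
    have int: "integrable ?N (\<lambda>x. M * \<bar>\<phi> x\<bar>)"
      using \<phi> by auto
    have le: "norm (complex_of_real (\<phi> x) * ?R x) \<le> M * \<bar>\<phi> x\<bar>" if "x \<in> {0<..<T}" for x
      using mult_left_mono[OF M(2)[OF that] abs_ge_zero[of "\<phi> x"]] by (simp add: norm_mult mult.commute)
    have [measurable]: "\<phi> \<in> borel_measurable ?N" "?R \<in> borel_measurable ?N"
      using \<phi> R(3) by auto
    have "integrable ?N (\<lambda>x. complex_of_real (\<phi> x) * ?R x)"
    proof (rule Bochner_Integration.integrable_bound[OF int])
      show "(\<lambda>x. complex_of_real (\<phi> x) * ?R x) \<in> borel_measurable ?N"
        by measurable
      show "AE x in ?N. norm (complex_of_real (\<phi> x) * ?R x) \<le> norm (M * \<bar>\<phi> x\<bar>)"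
        using le M(1) by (intro AE_I2) (auto simp: abs_mult)
    qed
    moreover have "norm (LINT x|?N. complex_of_real (\<phi> x) * ?R x) \<le> (LINT x|?N. M * \<bar>\<phi> x\<bar>)"
      by (rule Bochner_Integration.integral_norm_bound_integral[OF calculation int]) (use le in auto)
    ultimately show ?thesis by simp
  qed
  have GLS: "GLS_sub_integral \<alpha> 0 T 0 t f g = Re (c * (LINT x|?N. complex_of_real (D t x) * ?R x))"
    if "t \<in> {0..T}" for t
    unfolding GLS_sub_integral_def GLS_integral_def GLS_integral_complex_def cut[OF that] c_def D_def ..
  have main: "\<bar>GLS_sub_integral \<alpha> 0 T 0 t f g - GLS_sub_integral \<alpha> 0 T 0 s f g\<bar>
      \<le> norm c * (M * sub_const) * (t - s) powr (1 - \<alpha>)" if st: "0 \<le> s" "s \<le> t" "t \<le> T" for s t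
  proof -
    have int: "integrable ?N (D u)" if "u \<in> {0..T}" for u
      using WM_left_cut_integrable[OF that] by (simp add: D_def[abs_def])
    have dI: "(LINT x|?N. complex_of_real (D t x) * ?R x) - (LINT x|?N. complex_of_real (D s x) * ?R x)
        = (LINT x|?N. complex_of_real (D t x - D s x) * ?R x)"
      using prod_bound[OF int, of s] prod_bound[OF int, of t] st
      by (simp add: left_diff_distrib)
    have eq: "GLS_sub_integral \<alpha> 0 T 0 t f g - GLS_sub_integral \<alpha> 0 T 0 s f g =
        Re (c * (LINT x|?N. complex_of_real (D t x - D s x) * ?R x))" (is "_ = Re (c * ?I)")
      using st by (simp only: GLS dI[symmetric] right_diff_distrib minus_complex.sel atLeastAtMost_iff) (simp add: GLS)
    have "\<bar>Re (c * ?I)\<bar> \<le> norm c * norm ?I"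
      using abs_Re_le_cmod[of "c * ?I"] unfolding norm_mult .
    also have "\<dots> \<le> norm c * (M * (LINT x|?N. \<bar>D t x - D s x\<bar>))"
      using prod_bound[of "\<lambda>x. D t x - D s x"] WM_left_cut_diff_integral(1)[OF st]
      by (intro mult_left_mono) (auto simp: D_def)
    also have "\<dots> \<le> norm c * (M * (sub_const * (t - s) powr (1 - \<alpha>)))"
      using WM_left_cut_diff_integral(2)[OF st] M(1) by (intro mult_left_mono) (auto simp: D_def)
    finally show ?thesis unfolding eq by (simp only: mult.assoc)
  qed
  show "holder_on (1 - \<alpha>) {0..T} (\<lambda>t. GLS_sub_integral \<alpha> 0 T 0 t f g)"
    unfolding holder_on_def
  proof (intro exI[of _ "norm c * (M * sub_const)"] ballI)
    fix s t assume "s \<in> {0..T}" "t \<in> {0..T}"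
    then show "\<bar>GLS_sub_integral \<alpha> 0 T 0 t f g - GLS_sub_integral \<alpha> 0 T 0 s f g\<bar>
      \<le> norm c * (M * sub_const) * \<bar>t - s\<bar> powr (1 - \<alpha>)"
      using main[of s t] main[of t s] by (cases "s \<le> t") (auto simp: abs_minus_commute)
  qed
qed

text \<open>Guarantees that the driver given by the \<open>dg\<close>-integral starts at
  zero.\<close>

lemma GLS_sub_integral_empty: "GLS_sub_integral \<alpha> a b c c f g = 0"
  by (simp add: GLS_sub_integral_def GLS_integral_def GLS_integral_complex_def WM_left_def)

section \<open>Histories\<close>

lemma segment_mem:
  assumes "continuous_on {-r..T} x" "t \<in> {0..T}"
  shows "segment r x t \<in> mspace (hist_space r)"
proof -
  have "continuous_on {-r..0} (\<lambda>s. x (t + s))"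
    by (rule continuous_on_compose2[OF assms(1)]) (use assms(2) in \<open>auto intro!: continuous_intros\<close>)
  then show ?thesis
    unfolding hist_space_def mspace_path_space segment_def
    by (auto intro: continuous_on_eq)
qed

lemma hist_norm_le:
  assumes "r \<ge> 0" "\<And>s. s \<in> {-r..0} \<Longrightarrow> \<bar>\<phi> s\<bar> \<le> B"
  shows "hist_norm r \<phi> \<le> B"
  unfolding hist_norm_def using assms by (intro cSUP_least) auto

lemma hist_norm_nonneg:
  assumes "r \<ge> 0" "continuous_on {-r..0} \<phi>"
  shows "hist_norm r \<phi> \<ge> 0"
proof -
  have "bdd_above ((\<lambda>s. \<bar>\<phi> s\<bar>) ` {-r..0})"
    by (intro bounded_imp_bdd_above compact_imp_bounded compact_continuous_image continuous_intros assms) simp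
  then have "\<bar>\<phi> 0\<bar> \<le> hist_norm r \<phi>"
    unfolding hist_norm_def using assms(1) by (intro cSUP_upper) auto
  then show ?thesis by linarith
qed

text \<open>Uniform continuity of \<open>x\<close> makes the history depend continuously on time in
  the sup metric, so preimages of open sets are relatively open.\<close>

lemma segment_measurable:
  assumes x: "continuous_on {-r..T} x"
  shows "segment r x \<in> measurable (restrict_space borel {0..T}) (hist_borel r)"
  unfolding hist_borel_def
proof (rule measurable_measure_of)
  show "{U. openin (mtopology_of (hist_space r)) U} \<subseteq> Pow (mspace (hist_space r))"
    using openin_subset by fastforce
  show "segment r x \<in> space (restrict_space borel {0..T}) \<rightarrow> mspace (hist_space r)"
    using segment_mem[OF x] by (auto simp: space_restrict_space)
  fix U assume "U \<in> {U. openin (mtopology_of (hist_space r)) U}"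
  then have U: "openin (mtopology_of (hist_space r)) U" by simp
  define V where "V = segment r x -` U \<inter> {0..T}"
  have unif: "uniformly_continuous_on {-r..T} x"
    by (rule compact_uniformly_continuous[OF x]) simp
  have "\<exists>e>0. \<forall>t'\<in>{0..T}. dist t' t < e \<longrightarrow> t' \<in> V" if t: "t \<in> V" for t
  proof -
    interpret M: Metric_space "mspace (hist_space r)" "mdist (hist_space r)"
      by (rule Metric_space_mspace_mdist)
    have tU: "segment r x t \<in> U" and tT: "t \<in> {0..T}"
      using t by (auto simp: V_def)
    then obtain \<epsilon> where \<epsilon>: "\<epsilon> > 0" "M.mball (segment r x t) \<epsilon> \<subseteq> U"
      using U unfolding mtopology_of_def M.openin_mtopology by blast
    from unif \<epsilon>(1) obtain \<delta> where \<delta>: "\<delta> > 0"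
      "\<And>u v. u \<in> {-r..T} \<Longrightarrow> v \<in> {-r..T} \<Longrightarrow> dist v u < \<delta> \<Longrightarrow> dist (x v) (x u) < \<epsilon> / 2"
      unfolding uniformly_continuous_on_def by (meson half_gt_zero)
    have "t' \<in> V" if t': "t' \<in> {0..T}" "dist t' t < \<delta>" for t'
    proof -
      \<comment> \<open>Half of \<open>\<epsilon>\<close> is used because the supremum turns the
        strict pointwise bound into a weak one, while the ball is open.\<close>
      have "mdist (hist_space r) (segment r x t) (segment r x t') \<le> \<epsilon> / 2"
        unfolding hist_space_def path_space_def
      proof (rule mdist_cfunspace_le)
        fix s assume "s \<in> topspace (top_of_set {-r..0})"
        then have s: "s \<in> {-r..0}" by simp
        then have "dist (x (t + s)) (x (t' + s)) < \<epsilon> / 2"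
          using t' tT by (intro \<delta>(2)) (auto simp: dist_real_def)
        then show "mdist euclidean_metric (segment r x t s) (segment r x t' s) \<le> \<epsilon> / 2"
          using s by (simp add: segment_def)
      qed (use \<epsilon> in simp)
      then have "segment r x t' \<in> M.mball (segment r x t) \<epsilon>"
        using segment_mem[OF x tT] segment_mem[OF x t'(1)] \<epsilon>(1) by (simp add: M.in_mball)
      then show ?thesis
        using \<epsilon>(2) t' by (auto simp: V_def)
    qed
    with \<delta>(1) show ?thesis by blast
  qed
  then have "openin (top_of_set {0..T}) V"
    unfolding openin_euclidean_subtopology_iff by (auto simp: V_def)
  then obtain W where "open W" "V = {0..T} \<inter> W"
    by (auto simp: openin_open)
  then show "segment r x -` U \<inter> space (restrict_space borel {0..T}) \<in> sets (restrict_space borel {0..T})"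
    unfolding V_def by (auto simp: space_restrict_space sets_restrict_space)
qed

section \<open>The regulator\<close>

text \<open>The one-dimensional Skorokhod reflection at 0.\<close>

definition reflect :: "(real \<Rightarrow> real) \<Rightarrow> real \<Rightarrow> real" where
  "reflect z t = z t + regulator z t"

text \<open>\<open>Sup\<close> on the reals is informative only for sets bounded above. This
  condition, rather than continuity of \<open>z\<close>, is what the notion of solution
  supplies.\<close>

abbreviation regulated :: "(real \<Rightarrow> real) \<Rightarrow> real \<Rightarrow> bool" where
  "regulated z t \<equiv> bdd_above ((\<lambda>s. max (- z s) 0) ` {0..t})"

lemma regulated_mono: "regulated z t \<Longrightarrow> s \<le> t \<Longrightarrow> regulated z s"
  by (erule bdd_above_mono) auto

lemma regulated_continuous:
  assumes "continuous_on {0..t} z"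
  shows "regulated z t"
  by (intro bounded_imp_bdd_above compact_imp_bounded compact_continuous_image continuous_intros assms) simp

lemma regulator_upper:
  "regulated z t \<Longrightarrow> s \<in> {0..t} \<Longrightarrow> max (- z s) 0 \<le> regulator z t"
  unfolding regulator_def by (rule cSUP_upper)

lemma regulator_least:
  "0 \<le> t \<Longrightarrow> (\<And>s. s \<in> {0..t} \<Longrightarrow> max (- z s) 0 \<le> B) \<Longrightarrow> regulator z t \<le> B"
  unfolding regulator_def by (rule cSUP_least) auto

lemma regulator_0: "regulator z 0 = max (- z 0) 0"
  by (simp add: regulator_def)

text \<open>Taking negative parts and taking suprema both preserve a uniform bound on differences;
  the two inequalities follow by symmetry.\<close>

lemma regulator_diff:
  assumes "0 \<le> t" "regulated z t" "regulated w t" "\<And>s. s \<in> {0..t} \<Longrightarrow> \<bar>z s - w s\<bar> \<le> B"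
  shows "\<bar>regulator z t - regulator w t\<bar> \<le> B"
proof -
  have "regulator u t \<le> regulator v t + B"
    if "regulated v t" "\<And>s. s \<in> {0..t} \<Longrightarrow> \<bar>u s - v s\<bar> \<le> B" for u v
  proof (rule regulator_least[OF assms(1)])
    fix s assume "s \<in> {0..t}"
    then show "max (- u s) 0 \<le> regulator v t + B"
      using regulator_upper[OF that(1), of s] that(2)[of s] by linarith
  qed
  from this[of w z] this[of z w] assms show ?thesis
    by (fastforce simp: abs_le_iff abs_minus_commute)
qed

text \<open>The regulator is nondecreasing. After time \<open>s\<close> the negative part of
  \<open>z\<close> exceeds that at \<open>s\<close> by at most \<open>B\<close>, and the latter is
  already below \<open>regulator z s\<close>.\<close>

lemma regulator_increment:
  assumes "0 \<le> s" "s \<le> t" "regulated z t" "\<And>u. u \<in> {s..t} \<Longrightarrow> \<bar>z u - z s\<bar> \<le> B"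
  shows "\<bar>regulator z t - regulator z s\<bar> \<le> B"
proof -
  have reg_s: "regulated z s"
    by (rule regulated_mono[OF assms(3,2)])
  have B: "0 \<le> B"
    using assms(4)[of s] assms(2) by simp
  have "regulator z s \<le> regulator z t"
    using assms by (intro regulator_least regulator_upper) auto
  moreover have "regulator z t \<le> regulator z s + B"
  proof (rule regulator_least)
    fix u assume u: "u \<in> {0..t}"
    show "max (- z u) 0 \<le> regulator z s + B"
    proof (cases "u \<le> s")
      case True
      then show ?thesis
        using regulator_upper[OF reg_s, of u] u B by auto
    next
      case False
      then show ?thesis
        using regulator_upper[OF reg_s, of s] assms(4)[of u] assms(1) u by auto
    qed
  qed (use assms in simp)
  ultimately show ?thesis by linarith
qed

text \<open>One \<open>B\<close> comes from the path itself, the other from its regulator.\<close>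

lemma reflect_diff:
  assumes "0 \<le> t" "regulated z t" "regulated w t" "\<And>s. s \<in> {0..t} \<Longrightarrow> \<bar>z s - w s\<bar> \<le> B"
  shows "\<bar>reflect z t - reflect w t\<bar> \<le> 2 * B"
  using regulator_diff[OF assms] assms(4)[of t] assms(1) unfolding reflect_def by auto

section \<open>Hoelder functions\<close>

lemma holder_on_nonneg_const:
  assumes "holder_on \<mu> S f"
  shows "\<exists>C\<ge>0. \<forall>s\<in>S. \<forall>t\<in>S. \<bar>f t - f s\<bar> \<le> C * \<bar>t - s\<bar> powr \<mu>"
proof -
  from assms obtain C where C: "\<forall>s\<in>S. \<forall>t\<in>S. \<bar>f t - f s\<bar> \<le> C * \<bar>t - s\<bar> powr \<mu>"
    unfolding holder_on_def by blast
  have "C * \<bar>t - s\<bar> powr \<mu> \<le> \<bar>C\<bar> * \<bar>t - s\<bar> powr \<mu>" for s t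
    by (intro mult_right_mono) auto
  then show ?thesis
    using C by (intro exI[of _ "\<bar>C\<bar>"]) (meson abs_ge_zero order_trans)
qed

lemma holder_on_orderedI:
  assumes "\<And>s t. s \<in> S \<Longrightarrow> t \<in> S \<Longrightarrow> s \<le> t \<Longrightarrow> \<bar>f t - f s\<bar> \<le> C * (t - s) powr \<mu>"
  shows "holder_on \<mu> S f"
  unfolding holder_on_def
proof (intro exI[of _ C] ballI)
  fix s t assume "s \<in> S" "t \<in> S"
  then show "\<bar>f t - f s\<bar> \<le> C * \<bar>t - s\<bar> powr \<mu>"
    using assms[of s t] assms[of t s] by (cases "s \<le> t") (auto simp: abs_minus_commute)
qed

lemma powr_le_powr_bounded:
  fixes h c \<mu> \<nu> :: real
  assumes "0 \<le> h" "h \<le> c" "\<mu> \<le> \<nu>"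
  shows "h powr \<nu> \<le> c powr (\<nu> - \<mu>) * h powr \<mu>"
proof -
  have "h powr \<nu> = h powr (\<nu> - \<mu>) * h powr \<mu>"
    by (simp add: powr_add[symmetric])
  also have "\<dots> \<le> c powr (\<nu> - \<mu>) * h powr \<mu>"
    using assms by (intro mult_right_mono powr_mono2) auto
  finally show ?thesis .
qed

lemma holder_on_exponent_mono:
  assumes "holder_on \<nu> {a..b} f" "\<mu> \<le> \<nu>"
  shows "holder_on \<mu> {a..b} f"
proof -
  obtain C where C: "C \<ge> 0" "\<And>s t. s \<in> {a..b} \<Longrightarrow> t \<in> {a..b} \<Longrightarrow> \<bar>f t - f s\<bar> \<le> C * \<bar>t - s\<bar> powr \<nu>"
    using holder_on_nonneg_const[OF assms(1)] by blast
  show ?thesis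
  proof (rule holder_on_orderedI[where C = "C * (b - a) powr (\<nu> - \<mu>)"])
    fix s t assume st: "s \<in> {a..b}" "t \<in> {a..b}" "s \<le> t"
    have "C * (t - s) powr \<nu> \<le> C * ((b - a) powr (\<nu> - \<mu>) * (t - s) powr \<mu>)"
      using st assms(2) C(1) by (intro mult_left_mono powr_le_powr_bounded) auto
    with C(2)[OF st(1,2)] st(3) show "\<bar>f t - f s\<bar> \<le> C * (b - a) powr (\<nu> - \<mu>) * (t - s) powr \<mu>"
      by (simp add: mult.assoc)
  qed
qed

lemma holder_on_glue:
  assumes "holder_on \<mu> {a..c} f" "holder_on \<mu> {c..b} f" "a \<le> c" "c \<le> b" "\<mu> \<ge> 0"
  shows "holder_on \<mu> {a..b} f"
proof -
  obtain C where C: "C \<ge> 0" "\<And>s t. s \<in> {a..c} \<Longrightarrow> t \<in> {a..c} \<Longrightarrow> \<bar>f t - f s\<bar> \<le> C * \<bar>t - s\<bar> powr \<mu>"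
    using holder_on_nonneg_const[OF assms(1)] by blast
  obtain D where D: "D \<ge> 0" "\<And>s t. s \<in> {c..b} \<Longrightarrow> t \<in> {c..b} \<Longrightarrow> \<bar>f t - f s\<bar> \<le> D * \<bar>t - s\<bar> powr \<mu>"
    using holder_on_nonneg_const[OF assms(2)] by blast
  show ?thesis
  proof (rule holder_on_orderedI[where C = "C + D"])
    fix s t assume st: "s \<in> {a..b}" "t \<in> {a..b}" "s \<le> t"
    \<comment> \<open>The junction \<open>c\<close> projected to \<open>[s,t]\<close>. If both
      points lie on the same side of \<open>c\<close>, one of the two increments vanishes.\<close>
    define p where "p = max s (min t c)"
    have p: "s \<le> p" "p \<le> t"
      using st by (auto simp: p_def)
    have "\<bar>f p - f s\<bar> \<le> C * (p - s) powr \<mu>"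
      using C(2)[of s p] st p assms by (cases "s \<le> c") (auto simp: p_def)
    also have "\<dots> \<le> C * (t - s) powr \<mu>"
      using p C(1) assms by (intro mult_left_mono powr_mono2) auto
    finally have 1: "\<bar>f p - f s\<bar> \<le> C * (t - s) powr \<mu>" .
    have "\<bar>f t - f p\<bar> \<le> D * (t - p) powr \<mu>"
      using D(2)[of p t] st p assms by (cases "c \<le> t") (auto simp: p_def)
    also have "\<dots> \<le> D * (t - s) powr \<mu>"
      using p D(1) assms by (intro mult_left_mono powr_mono2) auto
    finally show "\<bar>f t - f s\<bar> \<le> (C + D) * (t - s) powr \<mu>"
      using 1 unfolding distrib_right by linarith
  qed
qed

lemma holder_on_add:
  assumes "holder_on \<mu> S f" "holder_on \<mu> S h"
  shows "holder_on \<mu> S (\<lambda>t. f t + h t)"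
proof -
  obtain C where C: "\<And>s t. s \<in> S \<Longrightarrow> t \<in> S \<Longrightarrow> \<bar>f t - f s\<bar> \<le> C * \<bar>t - s\<bar> powr \<mu>"
    using holder_on_nonneg_const[OF assms(1)] by blast
  obtain D where D: "\<And>s t. s \<in> S \<Longrightarrow> t \<in> S \<Longrightarrow> \<bar>h t - h s\<bar> \<le> D * \<bar>t - s\<bar> powr \<mu>"
    using holder_on_nonneg_const[OF assms(2)] by blast
  show ?thesis
    unfolding holder_on_def
  proof (intro exI[of _ "C + D"] ballI)
    fix s t assume "s \<in> S" "t \<in> S"
    from C[OF this] D[OF this] show "\<bar>f t + h t - (f s + h s)\<bar> \<le> (C + D) * \<bar>t - s\<bar> powr \<mu>"
      unfolding distrib_right by linarith
  qed
qed

lemma holder_on_cong: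
  "holder_on \<mu> S f \<Longrightarrow> (\<And>t. t \<in> S \<Longrightarrow> h t = f t) \<Longrightarrow> holder_on \<mu> S h"
  by (simp add: holder_on_def)

lemma holder_on_const: "holder_on \<mu> S (\<lambda>_. c)"
  unfolding holder_on_def by (intro exI[of _ 0]) simp

text \<open>The oscillation of \<open>z\<close> on \<open>[s,t]\<close> controls the increment of
  the regulator, so even the constant is kept.\<close>

lemma holder_on_regulator:
  assumes "holder_on \<mu> {0..T} z" "\<mu> > 0"
  shows "holder_on \<mu> {0..T} (regulator z)"
proof -
  obtain C where C: "C \<ge> 0" "\<And>s t. s \<in> {0..T} \<Longrightarrow> t \<in> {0..T} \<Longrightarrow> \<bar>z t - z s\<bar> \<le> C * \<bar>t - s\<bar> powr \<mu>"
    using holder_on_nonneg_const[OF assms(1)] by blast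
  have reg: "regulated z T"
    by (intro regulated_continuous holder_on_imp_continuous_on[OF assms(2,1)])
  show ?thesis
  proof (rule holder_on_orderedI)
    fix s t assume st: "s \<in> {0..T}" "t \<in> {0..T}" "s \<le> t"
    show "\<bar>regulator z t - regulator z s\<bar> \<le> C * (t - s) powr \<mu>"
    proof (rule regulator_increment)
      show "regulated z t"
        using regulated_mono[OF reg] st by simp
      fix u assume u: "u \<in> {s..t}"
      then have "\<bar>z u - z s\<bar> \<le> C * (u - s) powr \<mu>"
        using C(2)[of s u] st by auto
      also have "\<dots> \<le> C * (t - s) powr \<mu>"
        using u C(1) assms by (intro mult_left_mono powr_mono2) auto
      finally show "\<bar>z u - z s\<bar> \<le> C * (t - s) powr \<mu>" .
    qed (use st in auto)
  qed
qed

lemma holder_on_reflect: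
  assumes "holder_on \<mu> {0..T} z" "\<mu> > 0"
  shows "holder_on \<mu> {0..T} (reflect z)"
  unfolding reflect_def[abs_def] by (intro holder_on_add holder_on_regulator assms)

lemma continuous_on_Icc_bounded:
  fixes x :: "real \<Rightarrow> real"
  assumes "continuous_on {a..b} x"
  shows "\<exists>B\<ge>0. \<forall>s\<in>{a..b}. \<bar>x s\<bar> \<le> B"
proof -
  have "bounded (x ` {a..b})"
    by (intro compact_imp_bounded compact_continuous_image assms) simp
  then show ?thesis
    unfolding bounded_pos by (auto intro: less_imp_le)
qed

section \<open>The reflected equation with a given driver\<close>

locale delay_drift =
  fixes r T K L :: real and b :: "real \<Rightarrow> (real \<Rightarrow> real) \<Rightarrow> real"
  assumes r: "r > 0" and T: "T > 0" and K: "K \<ge> 0" and L: "L \<ge> 0"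
    and drift_measurable: "(\<lambda>(t, \<phi>). b t \<phi>) \<in> borel_measurable (restrict_space borel {0..T} \<Otimes>\<^sub>M hist_borel r)"
    and drift_growth: "\<And>t \<phi>. t \<in> {0..T} \<Longrightarrow> \<phi> \<in> mspace (hist_space r) \<Longrightarrow> \<bar>b t \<phi>\<bar> \<le> K * (1 + hist_norm r \<phi>)"
    and drift_lipschitz: "\<And>t \<phi> \<psi>. t \<in> {0..T} \<Longrightarrow> \<phi> \<in> mspace (hist_space r) \<Longrightarrow> \<psi> \<in> mspace (hist_space r) \<Longrightarrow>
       \<bar>b t \<phi> - b t \<psi>\<bar> \<le> L * hist_norm r (\<lambda>s. \<phi> s - \<psi> s)"
begin

definition drift_int :: "(real \<Rightarrow> real) \<Rightarrow> real \<Rightarrow> real" where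
  "drift_int x t = (LINT s|lebesgue_on {0..t}. b s (segment r x s))"

lemma drift_path_measurable:
  assumes x: "continuous_on {-r..T} x" and t: "t \<in> {0..T}"
  shows "(\<lambda>s. b s (segment r x s)) \<in> borel_measurable (lebesgue_on {0..t})"
proof -
  have "(\<lambda>s. (s, segment r x s)) \<in> restrict_space borel {0..T} \<rightarrow>\<^sub>M restrict_space borel {0..T} \<Otimes>\<^sub>M hist_borel r"
    using segment_measurable[OF x] by (intro measurable_Pair) auto
  from measurable_compose[OF this drift_measurable]
  have "(\<lambda>s. b s (segment r x s)) \<in> borel_measurable (restrict_space borel {0..T})"
    by simp
  \<comment> \<open>The drift is measurable only over \<open>[0,T]\<close>; extension by zero gives
    a Borel function on the line, which then restricts to the Lebesgue sets of
    \<open>[0,t]\<close>.\<close>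
  then have "(\<lambda>s. indicator {0..T} s *\<^sub>R b s (segment r x s)) \<in> borel_measurable borel"
    by (subst (asm) borel_measurable_restrict_space_iff) auto
  then have "(\<lambda>s. indicator {0..T} s *\<^sub>R b s (segment r x s)) \<in> borel_measurable (lebesgue_on {0..t})"
    by (rule borel_measurable_lebesgue_onI)
  then show ?thesis
    by (rule measurable_cong[THEN iffD1, rotated]) (use t in auto)
qed

lemma drift_path_bounded:
  assumes x: "continuous_on {-r..T} x"
  shows "\<exists>B\<ge>0. \<forall>s\<in>{0..T}. \<bar>b s (segment r x s)\<bar> \<le> B"
proof -
  obtain B where B: "B \<ge> 0" "\<And>s. s \<in> {-r..T} \<Longrightarrow> \<bar>x s\<bar> \<le> B"
    using continuous_on_Icc_bounded[OF x] by blast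
  have "\<bar>b s (segment r x s)\<bar> \<le> K * (1 + B)" if s: "s \<in> {0..T}" for s
  proof -
    have "hist_norm r (segment r x s) \<le> B"
      using r s by (intro hist_norm_le) (auto simp: segment_def intro!: B(2))
    then have "K * (1 + hist_norm r (segment r x s)) \<le> K * (1 + B)"
      using K by (intro mult_left_mono) auto
    then show ?thesis
      using drift_growth[OF s segment_mem[OF x s]] by linarith
  qed
  then show ?thesis
    using K B(1) by (intro exI[of _ "K * (1 + B)"]) auto
qed

lemma drift_path_integrable:
  assumes x: "continuous_on {-r..T} x" and t: "t \<in> {0..T}"
  shows "integrable (lebesgue_on {0..t}) (\<lambda>s. b s (segment r x s))"
proof -
  obtain B where B: "B \<ge> 0" "\<And>s. s \<in> {0..T} \<Longrightarrow> \<bar>b s (segment r x s)\<bar> \<le> B"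
    using drift_path_bounded[OF x] by blast
  show ?thesis
    by (rule dominated_lebesgue_on(1)[OF drift_path_measurable[OF x t] _ has_integral_const_real[of B] finite.emptyI])
      (use t B in auto)
qed

lemma drift_int_cong:
  assumes "t \<le> T" "\<And>s. s \<in> {-r..t} \<Longrightarrow> x s = x' s"
  shows "drift_int x t = drift_int x' t"
  unfolding drift_int_def
proof (rule Bochner_Integration.integral_cong[OF refl])
  fix s assume "s \<in> space (lebesgue_on {0..t})"
  then have "segment r x s = segment r x' s"
    unfolding segment_def by (intro restrict_ext assms(2)) auto
  then show "b s (segment r x s) = b s (segment r x' s)"
    by simp
qed

lemma drift_int_0: "drift_int x 0 = 0"
proof -
  have "AE s in lebesgue. s \<notin> {0::real}"
    by (rule AE_not_in) simp
  then have "AE s in lebesgue. indicator {0..0} s *\<^sub>R b s (segment r x s) = 0"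
    by (rule AE_mp) (auto intro!: AE_I2)
  then show ?thesis
    unfolding drift_int_def by (subst integral_restrict_space) (auto intro: integral_eq_zero_AE)
qed

text \<open>Along a continuous path the drift is bounded, so its integral is Lipschitz, and on a
  bounded interval the exponent may be lowered. Additivity over adjacent intervals is taken from the
  gauge integral.\<close>

lemma holder_on_drift_int:
  assumes x: "continuous_on {-r..T} x" and \<mu>: "\<mu> \<le> 1"
  shows "holder_on \<mu> {0..T} (drift_int x)"
proof -
  let ?f = "\<lambda>s. b s (segment r x s)"
  obtain B where B: "B \<ge> 0" "\<And>s. s \<in> {0..T} \<Longrightarrow> \<bar>?f s\<bar> \<le> B"
    using drift_path_bounded[OF x] by blast
  have drift_int: "drift_int x t = integral {0..t} ?f" and int: "?f integrable_on {0..t}" if "t \<in> {0..T}" for t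
    using drift_path_integrable[OF x that] unfolding drift_int_def
    by (auto intro: lebesgue_integral_eq_integral integrable_on_lebesgue_on)
  have "holder_on 1 {0..T} (drift_int x)"
  proof (rule holder_on_orderedI)
    fix s t assume st: "s \<in> {0..T}" "t \<in> {0..T}" "s \<le> t"
    have int': "?f integrable_on {s..t}"
      by (rule integrable_on_subinterval[OF int[OF st(2)]]) (use st in auto)
    have "integral {0..s} ?f + integral {s..t} ?f = integral {0..t} ?f"
      by (rule Henstock_Kurzweil_Integration.integral_combine) (use st int in auto)
    then have "drift_int x t - drift_int x s = integral {s..t} ?f"
      using drift_int st by simp
    moreover have "norm (integral {s..t} ?f) \<le> B * measure lborel {s..t}"
      by (rule has_integral_bound_real[OF B(1) finite.emptyI integrable_integral[OF int']])
        (use B(2) st in auto)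
    ultimately show "\<bar>drift_int x t - drift_int x s\<bar> \<le> B * (t - s) powr 1"
      using st by simp
  qed
  then show ?thesis
    using \<mu> by (rule holder_on_exponent_mono)
qed

text \<open>Looking back in time only lowers the weight, so the history distance at time
  \<open>s\<close> is at most \<open>d * exp (\<kappa> * s)\<close>. Integrating the exponential
  gains the factor \<open>1 / \<kappa>\<close>.\<close>

lemma drift_int_contraction:
  assumes x: "continuous_on {-r..T} x" and x': "continuous_on {-r..T} x'" and t: "t \<in> {0..T}"
    and "\<kappa> > 0" "d \<ge> 0" and d: "\<And>s. s \<in> {-r..t} \<Longrightarrow> \<bar>x s - x' s\<bar> \<le> d * exp (\<kappa> * s)"
  shows "\<bar>drift_int x t - drift_int x' t\<bar> \<le> L * d / \<kappa> * exp (\<kappa> * t)"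
proof -
  let ?f = "\<lambda>s. b s (segment r x s) - b s (segment r x' s)"
  have "drift_int x t - drift_int x' t = (LINT s|lebesgue_on {0..t}. ?f s)"
    unfolding drift_int_def by (rule Bochner_Integration.integral_diff[symmetric]) (intro drift_path_integrable x x' t)+
  moreover have "\<bar>LINT s|lebesgue_on {0..t}. ?f s\<bar> \<le> L * d * (exp (\<kappa> * t) / \<kappa> - exp (\<kappa> * 0) / \<kappa>)"
  proof (rule dominated_lebesgue_on(2)[where N = "{}"])
    show "?f \<in> borel_measurable (lebesgue_on {0..t})"
      by (intro borel_measurable_diff drift_path_measurable x x' t)
    have "((\<lambda>s. exp (\<kappa> * s)) has_integral (exp (\<kappa> * t) / \<kappa> - exp (\<kappa> * 0) / \<kappa>)) {0..t}"
      using t \<open>\<kappa> > 0\<close>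
      by (intro fundamental_theorem_of_calculus)
        (auto intro!: derivative_eq_intros simp flip: has_real_derivative_iff_has_vector_derivative)
    then show "((\<lambda>s. L * d * exp (\<kappa> * s)) has_integral L * d * (exp (\<kappa> * t) / \<kappa> - exp (\<kappa> * 0) / \<kappa>)) {0..t}"
      by (rule has_integral_mult_right)
    fix s assume "s \<in> {0..t} - {}"
    then have s: "s \<in> {0..T}" "s \<le> t"
      using t by auto
    have "hist_norm r (\<lambda>u. segment r x s u - segment r x' s u) \<le> d * exp (\<kappa> * s)"
    proof (rule hist_norm_le)
      fix u assume u: "u \<in> {-r..0}"
      have "\<bar>x (s + u) - x' (s + u)\<bar> \<le> d * exp (\<kappa> * (s + u))"
        using u s by (intro d) auto
      also have "\<dots> \<le> d * exp (\<kappa> * s)"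
        using u \<open>d \<ge> 0\<close> \<open>\<kappa> > 0\<close> by (intro mult_left_mono) auto
      finally show "\<bar>segment r x s u - segment r x' s u\<bar> \<le> d * exp (\<kappa> * s)"
        using u by (simp add: segment_def)
    qed (use r in simp)
    then have "L * hist_norm r (\<lambda>u. segment r x s u - segment r x' s u) \<le> L * (d * exp (\<kappa> * s))"
      using L by (rule mult_left_mono)
    then show "\<bar>?f s\<bar> \<le> L * d * exp (\<kappa> * s)"
      using drift_lipschitz[OF s(1) segment_mem[OF x s(1)] segment_mem[OF x' s(1)]] by (simp add: mult.assoc)
  qed auto
  moreover have "L * d * (exp (\<kappa> * t) / \<kappa> - exp (\<kappa> * 0) / \<kappa>) \<le> L * d / \<kappa> * exp (\<kappa> * t)"
    using L \<open>d \<ge> 0\<close> \<open>\<kappa> > 0\<close> by (simp add: field_simps)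
  ultimately show ?thesis by linarith
qed

definition free_path :: "real \<Rightarrow> (real \<Rightarrow> real) \<Rightarrow> (real \<Rightarrow> real) \<Rightarrow> real \<Rightarrow> real" where
  "free_path c m x t = c + drift_int x t + m t"

text \<open>The weight \<open>exp ((4 * L + 1) * t)\<close> turns the factor \<open>2 * L\<close> lost in the regulator and the drift
  into \<open>2 * L / (4 * L + 1) \<le> 1 / 2\<close>.\<close>

lemma reflect_contraction:
  assumes x: "continuous_on {-r..T} x" and x': "continuous_on {-r..T} x'" and t: "t \<in> {0..T}"
    and "d \<ge> 0" and d: "\<And>s. s \<in> {-r..t} \<Longrightarrow> \<bar>x s - x' s\<bar> \<le> d * exp ((4 * L + 1) * s)"
    and m: "\<And>s. s \<in> {0..t} \<Longrightarrow> m s = m' s"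
    and reg: "regulated (free_path c m x) t" "regulated (free_path c m' x') t"
  shows "\<bar>reflect (free_path c m x) t - reflect (free_path c m' x') t\<bar> \<le> d / 2 * exp ((4 * L + 1) * t)"
proof -
  have "\<bar>reflect (free_path c m x) t - reflect (free_path c m' x') t\<bar> \<le> 2 * (L * d / (4 * L + 1) * exp ((4 * L + 1) * t))"
  proof (rule reflect_diff[OF _ reg])
    fix s assume s: "s \<in> {0..t}"
    have "\<bar>drift_int x s - drift_int x' s\<bar> \<le> L * d / (4 * L + 1) * exp ((4 * L + 1) * s)"
      using s t L \<open>d \<ge> 0\<close> by (intro drift_int_contraction x x' d) auto
    also have "\<dots> \<le> L * d / (4 * L + 1) * exp ((4 * L + 1) * t)"
      using s L \<open>d \<ge> 0\<close> by (intro mult_left_mono) (auto intro!: mult_left_mono)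
    finally show "\<bar>free_path c m x s - free_path c m' x' s\<bar> \<le> L * d / (4 * L + 1) * exp ((4 * L + 1) * t)"
      using m[OF s] by (simp add: free_path_def)
  qed (use t in simp)
  also have "\<dots> = 2 * L / (4 * L + 1) * (d * exp ((4 * L + 1) * t))"
    by simp
  also have "\<dots> \<le> 1 / 2 * (d * exp ((4 * L + 1) * t))"
    using L \<open>d \<ge> 0\<close> by (intro mult_right_mono) (auto simp: field_simps)
  finally show ?thesis by simp
qed

text \<open>At a maximum point of the weighted distance the contraction estimate bounds the maximum
  by half of itself, so it is zero. The drivers are compared only up to \<open>\<tau>\<close>, which
  is what the stepwise argument along the delay requires.\<close>

lemma reflected_local_unique:
  assumes x: "continuous_on {-r..T} x" and x': "continuous_on {-r..T} x'" and \<tau>: "\<tau> \<in> {0..T}"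
    and init: "\<And>t. t \<in> {-r..0} \<Longrightarrow> x t = x' t"
    and m: "\<And>s. s \<in> {0..\<tau>} \<Longrightarrow> m s = m' s"
    and reg: "regulated (free_path c m x) \<tau>" "regulated (free_path c m' x') \<tau>"
    and eq: "\<And>t. t \<in> {0..\<tau>} \<Longrightarrow> x t = reflect (free_path c m x) t" "\<And>t. t \<in> {0..\<tau>} \<Longrightarrow> x' t = reflect (free_path c m' x') t"
    and t: "t \<in> {-r..\<tau>}"
  shows "x t = x' t"
proof -
  define e where "e s = \<bar>x s - x' s\<bar> * exp (- ((4 * L + 1) * s))" for s
  have "continuous_on {-r..\<tau>} e"
    unfolding e_def using \<tau>
    by (intro continuous_intros continuous_on_subset[OF x] continuous_on_subset[OF x']) auto
  then obtain s0 where s0: "s0 \<in> {-r..\<tau>}" and max: "\<And>s. s \<in> {-r..\<tau>} \<Longrightarrow> e s \<le> e s0"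
    using continuous_attains_sup[of "{-r..\<tau>}" e] t by (auto simp: compact_Icc)
  have diff: "\<bar>x s - x' s\<bar> = e s * exp ((4 * L + 1) * s)" for s
    by (simp add: e_def mult.assoc exp_add[symmetric])
  have "e s0 \<le> 0"
  proof (cases "s0 \<le> 0")
    case True
    then show ?thesis using init[of s0] s0 by (simp add: e_def)
  next
    case False
    then have s0': "s0 \<in> {0..\<tau>}" "s0 \<in> {0..T}" using s0 \<tau> by auto
    have "\<bar>reflect (free_path c m x) s0 - reflect (free_path c m' x') s0\<bar> \<le> e s0 / 2 * exp ((4 * L + 1) * s0)"
    proof (rule reflect_contraction[OF x x' s0'(2)])
      show "0 \<le> e s0" by (simp add: e_def)
      show "\<bar>x s - x' s\<bar> \<le> e s0 * exp ((4 * L + 1) * s)" if "s \<in> {-r..s0}" for s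
        unfolding diff using max[of s] that s0 by (intro mult_right_mono) auto
      show "m s = m' s" if "s \<in> {0..s0}" for s
        using m that s0 by auto
      show "regulated (free_path c m x) s0" "regulated (free_path c m' x') s0"
        using regulated_mono[OF reg(1)] regulated_mono[OF reg(2)] s0 by auto
    qed
    then have "e s0 * exp ((4 * L + 1) * s0) \<le> e s0 / 2 * exp ((4 * L + 1) * s0)"
      using eq(1)[OF s0'(1)] eq(2)[OF s0'(1)] by (simp only: diff[symmetric])
    then have "e s0 \<le> e s0 / 2"
      by (rule mult_right_le_imp_le) simp
    then show ?thesis by simp
  qed
  then have "\<bar>x t - x' t\<bar> \<le> 0"
    unfolding diff using max[OF t] by (intro mult_nonpos_nonneg) auto
  then show ?thesis by simp
qed

section \<open>Existence for a given driver by the contraction principle\<close>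

definition extend :: "(real \<Rightarrow> real) \<Rightarrow> (real \<Rightarrow> real) \<Rightarrow> (real \<Rightarrow> real) \<Rightarrow> real \<Rightarrow> real" where
  "extend \<eta> m x t = (if t \<le> 0 then \<eta> t else reflect (free_path (\<eta> 0) m x) t)"

context
  fixes \<eta> m :: "real \<Rightarrow> real" and \<mu> :: real
  assumes \<mu>: "0 < \<mu>" "\<mu> \<le> 1" and \<eta>: "holder_on \<mu> {-r..0} \<eta>" and \<eta>0: "\<eta> 0 \<ge> 0"
    and m: "holder_on \<mu> {0..T} m" and m0: "m 0 = 0"
begin

lemma holder_on_free_path:
  assumes "continuous_on {-r..T} x"
  shows "holder_on \<mu> {0..T} (free_path (\<eta> 0) m x)"
  unfolding free_path_def[abs_def] by (intro holder_on_add holder_on_const holder_on_drift_int assms \<mu> m)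

lemma regulated_free_path:
  assumes "continuous_on {-r..T} x"
  shows "regulated (free_path (\<eta> 0) m x) T"
  by (intro regulated_continuous holder_on_imp_continuous_on[OF \<mu>(1)] holder_on_free_path assms)

text \<open>Nonnegativity of \<open>\<eta> 0\<close> makes the regulator vanish at time 0, so the
  reflected path joins the initial segment continuously.\<close>

lemma reflect_free_path_0: "reflect (free_path (\<eta> 0) m x) 0 = \<eta> 0"
  using \<eta>0 by (simp add: reflect_def regulator_0 free_path_def drift_int_0 m0)

lemma extend_nonneg: "t \<in> {0..T} \<Longrightarrow> extend \<eta> m x t = reflect (free_path (\<eta> 0) m x) t"
  by (cases "t = 0") (auto simp: extend_def reflect_free_path_0)

lemma holder_on_extend:
  assumes "continuous_on {-r..T} x"
  shows "holder_on \<mu> {-r..T} (extend \<eta> m x)"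
proof (rule holder_on_glue)
  show "holder_on \<mu> {-r..0} (extend \<eta> m x)"
    using \<eta> by (rule holder_on_cong) (simp add: extend_def)
  show "holder_on \<mu> {0..T} (extend \<eta> m x)"
    using holder_on_reflect[OF holder_on_free_path[OF assms] \<mu>(1)] by (rule holder_on_cong) (simp add: extend_nonneg)
qed (use r T \<mu> in auto)

text \<open>A path is stored divided by the exponential weight. The sup metric on bounded continuous
  functions thus becomes the weighted distance on a complete space.\<close>

definition unweight :: "(real \<Rightarrow>\<^sub>C real) \<Rightarrow> real \<Rightarrow> real" where
  "unweight u s = exp ((4 * L + 1) * s) * apply_bcontfun u s"

text \<open>Clamping produces a bounded continuous function on the whole line from values on
  \<open>[-r,T]\<close>.\<close>

definition picard :: "(real \<Rightarrow>\<^sub>C real) \<Rightarrow> (real \<Rightarrow>\<^sub>C real)" where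
  "picard u = Bcontfun (clamp_ext (-r) T (\<lambda>s. exp (- ((4 * L + 1) * s)) * extend \<eta> m (unweight u) s))"

lemma continuous_unweight: "continuous_on S (unweight u)"
proof -
  have "continuous_on S (apply_bcontfun u)"
    using apply_bcontfun[of u] continuous_on_subset by (auto simp: bcontfun_def)
  then show ?thesis
    unfolding unweight_def by (intro continuous_intros)
qed

lemma apply_picard:
  "apply_bcontfun (picard u) = clamp_ext (-r) T (\<lambda>s. exp (- ((4 * L + 1) * s)) * extend \<eta> m (unweight u) s)"
proof -
  let ?f = "\<lambda>s. exp (- ((4 * L + 1) * s)) * extend \<eta> m (unweight u) s"
  have cont: "continuous_on {-r..T} ?f"
    by (intro continuous_intros holder_on_imp_continuous_on[OF \<mu>(1)] holder_on_extend continuous_unweight)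
  then obtain B where B: "\<And>s. s \<in> {-r..T} \<Longrightarrow> \<bar>?f s\<bar> \<le> B"
    using continuous_on_Icc_bounded by blast
  have "clamp_ext (-r) T ?f \<in> bcontfun"
  proof (rule bcontfun_normI)
    show "continuous_on UNIV (clamp_ext (-r) T ?f)"
      using r T cont by (intro continuous_clamp_ext) auto
    show "norm (clamp_ext (-r) T ?f s) \<le> B" for s
      using B[of "max (-r) (min T s)"] r T by (simp add: clamp_ext_def)
  qed
  then show ?thesis
    by (simp add: picard_def Bcontfun_inverse)
qed

text \<open>The distance at any \<open>s\<close> is the distance at its clamped point
  \<open>c\<close>. For \<open>c \<le> 0\<close> both images equal the initial datum; otherwise
  \<open>reflect_contraction\<close> applies and the weights cancel.\<close>

lemma picard_contraction: "dist (picard u) (picard v) \<le> 1 / 2 * dist u v"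
proof (rule dist_bound)
  fix s
  define c where "c = max (-r) (min T s)"
  have c: "c \<in> {-r..T}"
    using r T by (auto simp: c_def)
  have "\<bar>extend \<eta> m (unweight u) c - extend \<eta> m (unweight v) c\<bar> \<le> dist u v / 2 * exp ((4 * L + 1) * c)"
  proof (cases "c \<le> 0")
    case True
    then show ?thesis by (simp add: extend_def)
  next
    case False
    then have cT: "c \<in> {0..T}" using c by simp
    have reg: "regulated (free_path (\<eta> 0) m (unweight w)) c" for w
      using regulated_mono[OF regulated_free_path[OF continuous_unweight]] c by simp
    have "\<bar>unweight u s - unweight v s\<bar> \<le> dist u v * exp ((4 * L + 1) * s)" for s
    proof -
      have "unweight u s - unweight v s = (u s - v s) * exp ((4 * L + 1) * s)"
        by (simp add: unweight_def algebra_simps)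
      then show ?thesis
        using mult_right_mono[OF dist_bounded[of u s v], of "exp ((4 * L + 1) * s)"]
        by (simp add: abs_mult dist_real_def)
    qed
    from reflect_contraction[OF continuous_unweight continuous_unweight cT zero_le_dist this refl reg reg]
    show ?thesis
      unfolding extend_nonneg[OF cT] .
  qed
  then have "exp (- ((4 * L + 1) * c)) * \<bar>extend \<eta> m (unweight u) c - extend \<eta> m (unweight v) c\<bar>
      \<le> exp (- ((4 * L + 1) * c)) * (dist u v / 2 * exp ((4 * L + 1) * c))"
    by (rule mult_left_mono) simp
  also have "\<dots> = 1 / 2 * dist u v"
    by (simp add: exp_minus)
  finally show "dist (picard u s) (picard v s) \<le> 1 / 2 * dist u v"
    by (simp add: apply_picard clamp_ext_def c_def[symmetric] dist_real_def abs_mult flip: right_diff_distrib)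
qed

lemma reflected_existence:
  "\<exists>x \<in> mspace (path_space (-r) T). holder_on \<mu> {-r..T} x \<and> (\<forall>t\<in>{-r..0}. x t = \<eta> t) \<and>
     regulated (free_path (\<eta> 0) m x) T \<and> (\<forall>t\<in>{0..T}. x t = reflect (free_path (\<eta> 0) m x) t)"
proof -
  have "\<exists>!u. picard u = u"
    by (rule banach_fix_type[of "1/2"]) (use picard_contraction in auto)
  then obtain u where u: "picard u = u" by blast
  \<comment> \<open>Restriction gives an extensional function, hence an element of the path space.
    The equation on \<open>[0,T]\<close> only evaluates the path on \<open>[-r,T]\<close>, so it
    carries over from the unrestricted fixed point.\<close>
  define x where "x = restrict (unweight u) {-r..T}"
  have fix_u: "unweight u s = extend \<eta> m (unweight u) s" if s: "s \<in> {-r..T}" for s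
  proof -
    have "u s = exp (- ((4 * L + 1) * s)) * extend \<eta> m (unweight u) s"
      by (subst u[symmetric]) (simp add: apply_picard clamp_ext_eq[OF s])
    then show ?thesis
      by (simp add: unweight_def exp_minus)
  qed
  have free_path_eq: "free_path (\<eta> 0) m x t = free_path (\<eta> 0) m (unweight u) t" if "t \<in> {0..T}" for t
    unfolding free_path_def using that by (subst drift_int_cong[of t x "unweight u"]) (auto simp: x_def)
  have reflect_eq: "reflect (free_path (\<eta> 0) m x) t = reflect (free_path (\<eta> 0) m (unweight u)) t" if "t \<in> {0..T}" for t
    unfolding reflect_def regulator_def using that free_path_eq by (auto intro!: SUP_cong)
  have "holder_on \<mu> {-r..T} (unweight u)"
    using holder_on_extend[OF continuous_unweight] by (rule holder_on_cong) (rule fix_u)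
  then have hx: "holder_on \<mu> {-r..T} x"
    by (rule holder_on_cong) (simp add: x_def)
  then have cx: "continuous_on {-r..T} x"
    by (rule holder_on_imp_continuous_on[OF \<mu>(1)])
  show ?thesis
  proof (intro bexI[of _ x] conjI ballI)
    show "x \<in> mspace (path_space (-r) T)"
      using cx by (simp add: mspace_path_space) (simp add: x_def)
    show "x t = \<eta> t" if "t \<in> {-r..0}" for t
      using that T fix_u[of t] by (simp add: x_def extend_def)
    show "x t = reflect (free_path (\<eta> 0) m x) t" if "t \<in> {0..T}" for t
      using that r fix_u[of t] reflect_eq[of t] extend_nonneg[of t] by (simp add: x_def)
  qed (fact hx regulated_free_path[OF cx])+
qed

end

end

section \<open>The delay equation\<close>

text \<open>The constants may be replaced by their absolute values because the history norm of a
  continuous function is nonnegative.\<close>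

lemma drift_coeff_imp_delay_drift:
  assumes "drift_coeff r T b" "r > 0" "T > 0"
  shows "\<exists>K L. delay_drift r T K L b"
proof -
  from assms(1) obtain K L where
    meas: "(\<lambda>(t, \<phi>). b t \<phi>) \<in> borel_measurable (restrict_space borel {0..T} \<Otimes>\<^sub>M hist_borel r)"
    and K: "\<forall>t\<in>{0..T}. \<forall>\<phi>\<in>mspace (hist_space r). \<bar>b t \<phi>\<bar> \<le> K * (1 + hist_norm r \<phi>)"
    and L: "\<forall>t\<in>{0..T}. \<forall>\<phi>\<in>mspace (hist_space r). \<forall>\<psi>\<in>mspace (hist_space r).
        \<bar>b t \<phi> - b t \<psi>\<bar> \<le> L * hist_norm r (\<lambda>s. \<phi> s - \<psi> s)"
    unfolding drift_coeff_def by blast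
  have "delay_drift r T \<bar>K\<bar> \<bar>L\<bar> b"
  proof unfold_locales
    fix t \<phi> assume t: "t \<in> {0..T}" and \<phi>: "\<phi> \<in> mspace (hist_space r)"
    have "continuous_on {-r..0} \<phi>"
      using \<phi> by (simp add: hist_space_def mspace_path_space)
    then have "K * (1 + hist_norm r \<phi>) \<le> \<bar>K\<bar> * (1 + hist_norm r \<phi>)"
      using hist_norm_nonneg[of r \<phi>] assms(2) by (intro mult_right_mono) auto
    then show "\<bar>b t \<phi>\<bar> \<le> \<bar>K\<bar> * (1 + hist_norm r \<phi>)"
      using K t \<phi> by force
  next
    fix t \<phi> \<psi> assume t: "t \<in> {0..T}" and \<phi>: "\<phi> \<in> mspace (hist_space r)" and \<psi>: "\<psi> \<in> mspace (hist_space r)"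
    have "continuous_on {-r..0} (\<lambda>s. \<phi> s - \<psi> s)"
      using \<phi> \<psi> by (intro continuous_intros) (simp_all add: hist_space_def mspace_path_space)
    then have "L * hist_norm r (\<lambda>s. \<phi> s - \<psi> s) \<le> \<bar>L\<bar> * hist_norm r (\<lambda>s. \<phi> s - \<psi> s)"
      using assms(2) by (intro mult_right_mono hist_norm_nonneg) auto
    then show "\<bar>b t \<phi> - b t \<psi>\<bar> \<le> \<bar>L\<bar> * hist_norm r (\<lambda>s. \<phi> s - \<psi> s)"
      using L t \<phi> \<psi> by force
  qed (use assms meas in auto)
  then show ?thesis by blast
qed

text \<open>Testing the functional \<open>\<sigma>(t, \<phi>(-r))\<close> on constant histories recovers the regularity of \<open>\<sigma>\<close>.\<close>

lemma diffusion_coeff_scalar: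
  assumes S: "diffusion_coeff r T \<beta> (\<lambda>t \<phi>. \<sigma> t (\<phi> (-r)))" and r: "r > 0"
  shows "\<exists>C\<ge>0. (\<forall>s\<in>{0..T}. \<forall>t\<in>{0..T}. \<forall>u. \<bar>\<sigma> t u - \<sigma> s u\<bar> \<le> C * \<bar>t - s\<bar> powr \<beta> * (1 + \<bar>u\<bar>)) \<and>
     (\<forall>t\<in>{0..T}. \<forall>u v. \<bar>\<sigma> t u - \<sigma> t v\<bar> \<le> C * \<bar>u - v\<bar>)"
proof -
  let ?S = "\<lambda>t \<phi>. \<sigma> t (\<phi> (-r))"
  define h where "h u = restrict (\<lambda>_. u) {-r..0}" for u :: real
  have h: "h u \<in> mspace (hist_space r)" for u
    unfolding hist_space_def mspace_path_space h_def
    by (auto intro: continuous_on_eq[OF continuous_on_const])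
  have hr: "h u (-r) = u" for u
    using r by (simp add: h_def)
  have norm_h: "hist_norm r (h u) = \<bar>u\<bar>" for u
    using r by (simp add: hist_norm_def h_def cong: SUP_cong_simp)
  have norm_diff: "hist_norm r (\<lambda>s. h u s - h v s) = \<bar>u - v\<bar>" for u v
    using r by (simp add: hist_norm_def h_def cong: SUP_cong_simp)
  from S obtain C D where
    C: "\<forall>s\<in>{0..T}. \<forall>t\<in>{0..T}. \<forall>\<phi>\<in>mspace (hist_space r).
        \<bar>?S t \<phi> - ?S s \<phi>\<bar> \<le> C * \<bar>t - s\<bar> powr \<beta> * (1 + hist_norm r \<phi>)"
    and D: "\<forall>t\<in>{0..T}. \<forall>\<phi>\<in>mspace (hist_space r). \<forall>\<psi>\<in>mspace (hist_space r).
        \<bar>?S t \<phi> - ?S t \<psi>\<bar> \<le> D * hist_norm r (\<lambda>s. \<phi> s - \<psi> s)"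
    unfolding diffusion_coeff_def by blast
  define E where "E = max \<bar>C\<bar> \<bar>D\<bar>"
  have "\<bar>\<sigma> t u - \<sigma> s u\<bar> \<le> E * \<bar>t - s\<bar> powr \<beta> * (1 + \<bar>u\<bar>)" if "s \<in> {0..T}" "t \<in> {0..T}" for s t u
  proof -
    have "\<bar>\<sigma> t u - \<sigma> s u\<bar> \<le> C * \<bar>t - s\<bar> powr \<beta> * (1 + \<bar>u\<bar>)"
      using bspec[OF bspec[OF bspec[OF C that(1)] that(2)] h[of u]] by (simp add: hr norm_h)
    also have "\<dots> \<le> E * \<bar>t - s\<bar> powr \<beta> * (1 + \<bar>u\<bar>)"
      by (intro mult_right_mono) (auto simp: E_def)
    finally show ?thesis .
  qed
  moreover have "\<bar>\<sigma> t u - \<sigma> t v\<bar> \<le> E * \<bar>u - v\<bar>" if "t \<in> {0..T}" for t u v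
  proof -
    have "\<bar>\<sigma> t u - \<sigma> t v\<bar> \<le> D * \<bar>u - v\<bar>"
      using bspec[OF bspec[OF bspec[OF D that] h[of u]] h[of v]] by (simp add: hr norm_diff)
    also have "\<dots> \<le> E * \<bar>u - v\<bar>"
      by (intro mult_right_mono) (auto simp: E_def)
    finally show ?thesis .
  qed
  moreover have "E \<ge> 0"
    by (simp add: E_def)
  ultimately show ?thesis by blast
qed

text \<open>The increment is split at \<open>\<sigma> s (x (t - r))\<close>. The time part has
  exponent \<open>\<beta>\<close>, lowered to \<open>\<mu>\<close> at the cost of
  \<open>T powr (\<beta> - \<mu>)\<close>, and the growth factor is bounded by \<open>1 + B\<close>;
  the space part inherits the exponent of \<open>x\<close>.\<close>

lemma holder_on_diffusion:
  assumes S: "diffusion_coeff r T \<beta> (\<lambda>t \<phi>. \<sigma> t (\<phi> (-r)))" and r: "r > 0"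
    and \<mu>: "0 < \<mu>" "\<mu> \<le> \<beta>" and x: "holder_on \<mu> {-r..T} x"
  shows "holder_on \<mu> {0..T} (\<lambda>s. \<sigma> s (x (s - r)))"
proof -
  obtain C where C: "C \<ge> 0"
    and time: "\<And>s t u. s \<in> {0..T} \<Longrightarrow> t \<in> {0..T} \<Longrightarrow> \<bar>\<sigma> t u - \<sigma> s u\<bar> \<le> C * \<bar>t - s\<bar> powr \<beta> * (1 + \<bar>u\<bar>)"
    and space: "\<And>t u v. t \<in> {0..T} \<Longrightarrow> \<bar>\<sigma> t u - \<sigma> t v\<bar> \<le> C * \<bar>u - v\<bar>"
    using diffusion_coeff_scalar[OF S r] by blast
  obtain D where D: "D \<ge> 0" "\<And>s t. s \<in> {-r..T} \<Longrightarrow> t \<in> {-r..T} \<Longrightarrow> \<bar>x t - x s\<bar> \<le> D * \<bar>t - s\<bar> powr \<mu>"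
    using holder_on_nonneg_const[OF x] by blast
  obtain B where B: "B \<ge> 0" "\<And>s. s \<in> {-r..T} \<Longrightarrow> \<bar>x s\<bar> \<le> B"
    using continuous_on_Icc_bounded[OF holder_on_imp_continuous_on[OF \<mu>(1) x]] by blast
  show ?thesis
  proof (rule holder_on_orderedI[where C = "C * T powr (\<beta> - \<mu>) * (1 + B) + C * D"])
    fix s t assume st: "s \<in> {0..T}" "t \<in> {0..T}" "s \<le> t"
    have "\<bar>\<sigma> t (x (t - r)) - \<sigma> s (x (t - r))\<bar> \<le> C * \<bar>t - s\<bar> powr \<beta> * (1 + \<bar>x (t - r)\<bar>)"
      by (rule time) (use st in auto)
    also have "\<dots> \<le> C * (T powr (\<beta> - \<mu>) * (t - s) powr \<mu>) * (1 + B)"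
      using st \<mu> C B r powr_le_powr_bounded[of "t - s" T \<mu> \<beta>]
      by (intro mult_mono mult_left_mono add_left_mono B(2)) auto
    finally have 1: "\<bar>\<sigma> t (x (t - r)) - \<sigma> s (x (t - r))\<bar> \<le> C * T powr (\<beta> - \<mu>) * (1 + B) * (t - s) powr \<mu>"
      by (simp only: mult_ac)
    have "\<bar>\<sigma> s (x (t - r)) - \<sigma> s (x (s - r))\<bar> \<le> C * \<bar>x (t - r) - x (s - r)\<bar>"
      by (rule space) (use st in auto)
    also have "\<dots> \<le> C * (D * (t - s) powr \<mu>)"
      using D(2)[of "s - r" "t - r"] st r C by (intro mult_left_mono) auto
    finally have 2: "\<bar>\<sigma> s (x (t - r)) - \<sigma> s (x (s - r))\<bar> \<le> C * D * (t - s) powr \<mu>"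
      by (simp only: mult_ac)
    from 1 2 show "\<bar>\<sigma> t (x (t - r)) - \<sigma> s (x (s - r))\<bar>
        \<le> (C * T powr (\<beta> - \<mu>) * (1 + B) + C * D) * (t - s) powr \<mu>"
      unfolding distrib_right by linarith
  qed
qed

theorem theorem4p2:
  fixes T r \<theta> \<alpha> \<beta> :: real
    and \<eta> g :: "real \<Rightarrow> real"
    and b :: "real \<Rightarrow> (real \<Rightarrow> real) \<Rightarrow> real"
    and \<sigma> :: "real \<Rightarrow> real \<Rightarrow> real"
  assumes "T > 0" and "r > 0"
    and "0 < \<theta>" and "\<theta> \<le> 1"
    and "\<forall>t\<in>{-r..0}. \<eta> t \<ge> 0"
    and "holder_on \<theta> {-r..0} \<eta>"
    and "drift_coeff r T b"
    and "0 < \<beta>" and "\<beta> < 1"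
    and "diffusion_coeff r T \<beta> (\<lambda>t \<phi>. \<sigma> t (\<phi> (-r)))"
    and "0 < \<alpha>" and "\<alpha> < min (1/2) (min \<theta> \<beta>)"
    and "g \<in> W_space \<alpha> T"
  shows "\<exists>!x. reflected_delay_solution \<alpha> r T \<eta> b \<sigma> g x"
proof -
  note T = \<open>T > 0\<close> and r = \<open>r > 0\<close>
  \<comment> \<open>The three terms are the regularities of \<open>\<sigma>\<close> in time, of the
    initial path and of the \<open>dg\<close>-integral. The bound \<open>\<alpha> < 1/2\<close>
    gives \<open>\<alpha> < 1 - \<alpha>\<close>, hence \<open>\<alpha> < \<mu>\<close>.\<close>
  define \<mu> where "\<mu> = min \<beta> (min \<theta> (1 - \<alpha>))"
  have \<mu>: "0 < \<mu>" "\<mu> \<le> 1" "\<mu> \<le> \<beta>" "\<mu> \<le> \<theta>" "\<mu> \<le> 1 - \<alpha>" "\<alpha> < \<mu>" "\<alpha> < 1"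
    using assms(3,8,11,12) by (auto simp: \<mu>_def)
  have \<eta>: "holder_on \<mu> {-r..0} \<eta>"
    by (rule holder_on_exponent_mono[OF \<open>holder_on \<theta> {-r..0} \<eta>\<close> \<mu>(4)])
  have \<eta>0: "\<eta> 0 \<ge> 0"
    using assms(5) r by simp
  obtain K L where "delay_drift r T K L b"
    using drift_coeff_imp_delay_drift[OF \<open>drift_coeff r T b\<close> r T] by blast
  then interpret delay_drift r T K L b .
  define driver where "driver x t = GLS_sub_integral \<alpha> 0 T 0 t (\<lambda>s. \<sigma> s (x (s - r))) g" for x t
  have unref: "unreflected \<alpha> r T \<eta> b \<sigma> g x = free_path (\<eta> 0) (driver x) x" for x
    by (rule ext) (simp add: unreflected_def free_path_def driver_def drift_int_def)
  define paths where "paths = mspace (path_space (-r) T)"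
  have cont: "continuous_on {-r..T} x" if "x \<in> paths" for x
    using that by (simp add: paths_def mspace_path_space)
  \<comment> \<open>The driver is decoupled from the path: a solution of the delay equation is a
    path \<open>x\<close> with \<open>solves (driver x) x\<close> for which all integrals
    exist.\<close>
  define solves where "solves m x \<longleftrightarrow> x \<in> paths \<and> (\<forall>t\<in>{-r..0}. x t = \<eta> t) \<and>
     regulated (free_path (\<eta> 0) m x) T \<and> (\<forall>t\<in>{0..T}. x t = reflect (free_path (\<eta> 0) m x) t)" for m x
  have sol_solves: "solves (driver x) x" if "reflected_delay_solution \<alpha> r T \<eta> b \<sigma> g x" for x
    using that unfolding reflected_delay_solution_def solves_def unref reflect_def paths_def
    by (elim conjE) (intro conjI; assumption)
  have driver_holder: "holder_on \<mu> {0..T} (driver x)"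
    and driver_defined: "\<forall>t\<in>{0..T}. GLS_sub_defined \<alpha> 0 T 0 t (\<lambda>s. \<sigma> s (x (s - r))) g"
    if x: "holder_on \<mu> {-r..T} x" for x
  proof -
    have f: "holder_on \<mu> {0..T} (\<lambda>s. \<sigma> s (x (s - r)))"
      by (rule holder_on_diffusion[OF assms(10) r \<mu>(1,3) x])
    note GLS_sub_holder[OF T \<open>0 < \<alpha>\<close> \<mu>(6,7) f \<open>g \<in> W_space \<alpha> T\<close>]
    then show "holder_on \<mu> {0..T} (driver x)"
      "\<forall>t\<in>{0..T}. GLS_sub_defined \<alpha> 0 T 0 t (\<lambda>s. \<sigma> s (x (s - r))) g"
      unfolding driver_def using \<mu>(5) by (auto intro: holder_on_exponent_mono)
  qed
  \<comment> \<open>For \<open>0 < s < t \<le> (n + 1) * r\<close> the delayed time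
    \<open>s - r\<close> lies between \<open>-r\<close> and \<open>n * r\<close>.\<close>
  have driver_local: "driver x t = driver x' t" if "\<And>s. s \<in> {-r..min (real n * r) T} \<Longrightarrow> x s = x' s"
    "t \<in> {0..min (real (Suc n) * r) T}" for x x' t n
  proof -
    have "indicator {0<..<t} s * \<sigma> s (x (s - r)) = indicator {0<..<t} s * \<sigma> s (x' (s - r))" for s
    proof (cases "s \<in> {0<..<t}")
      case True
      then have "x (s - r) = x' (s - r)"
        using that(2) r by (intro that(1)) (auto simp: distrib_right)
      then show ?thesis by simp
    qed simp
    then show ?thesis
      unfolding driver_def GLS_sub_integral_def by presburger
  qed
  \<comment> \<open>Agreement of two driving paths up to \<open>n * r\<close> yields agreement of
    the driven paths up to \<open>(n + 1) * r\<close>, by local uniqueness.\<close>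
  have step: "y s = y' s" if "solves (driver x) y" "solves (driver x') y'"
    "\<And>s. s \<in> {-r..min (real n * r) T} \<Longrightarrow> x s = x' s" "s \<in> {-r..min (real (Suc n) * r) T}" for x x' y y' n s
  proof (rule reflected_local_unique[where \<tau> = "min (real (Suc n) * r) T"
      and m = "driver x" and m' = "driver x'" and c = "\<eta> 0" and x = y and x' = y'])
    show "continuous_on {-r..T} y" "continuous_on {-r..T} y'"
      using that cont by (auto simp: solves_def)
    show "driver x s = driver x' s" if "s \<in> {0..min (real (Suc n) * r) T}" for s
      using driver_local[OF _ that] \<open>\<And>s. s \<in> {-r..min (real n * r) T} \<Longrightarrow> x s = x' s\<close> by blast
    show "regulated (free_path (\<eta> 0) (driver x) y) (min (real (Suc n) * r) T)"
      "regulated (free_path (\<eta> 0) (driver x') y') (min (real (Suc n) * r) T)"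
      using that by (auto simp: solves_def intro: regulated_mono)
  qed (use that T r in \<open>auto simp: solves_def\<close>)
  obtain N :: nat where N: "T < real N * r"
    using reals_Archimedean3[OF r] by blast
  then have min_N: "min (real N * r) T = T" by simp
  have unique: "x = x'" if x: "reflected_delay_solution \<alpha> r T \<eta> b \<sigma> g x"
    and x': "reflected_delay_solution \<alpha> r T \<eta> b \<sigma> g x'" for x x'
  proof -
    note s = sol_solves[OF x] and s' = sol_solves[OF x']
    \<comment> \<open>Each solution is its own driving path, so \<open>step\<close> applies to
      arbitrary continuous solutions. The case \<open>n = 0\<close> is the common initial
      datum.\<close>
    have "\<forall>s\<in>{-r..min (real n * r) T}. x s = x' s" for n
    proof (induction n)
      case 0
      then show ?case using s s' by (auto simp: solves_def)
    next
      case (Suc n)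
      then show ?case using step[OF s s', of n] by blast
    qed
    from this[of N] have "x s = x' s" if "s \<in> {-r..T}" for s
      using that by (simp add: min_N)
    then show ?thesis
      using s s' unfolding solves_def paths_def mspace_path_space by (auto intro: extensionalityI)
  qed
  have solve: "\<exists>y. holder_on \<mu> {-r..T} y \<and> solves (driver x) y" if x: "holder_on \<mu> {-r..T} x" for x
    using reflected_existence[OF \<mu>(1,2) \<eta> \<eta>0 driver_holder[OF x]]
    by (auto simp: solves_def paths_def driver_def GLS_sub_integral_empty)
  \<comment> \<open>Here \<open>y\<close> is the image of \<open>x\<close> under the solution map,
    and the two agree up to \<open>n * r\<close>. The induction passes from \<open>(x, y)\<close> to
    \<open>(y, y')\<close> with \<open>y'\<close> driven by \<open>y\<close>.\<close>
  have approx: "\<exists>x y. holder_on \<mu> {-r..T} x \<and> x \<in> paths \<and> holder_on \<mu> {-r..T} y \<and> solves (driver x) y \<and>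
      (\<forall>s\<in>{-r..min (real n * r) T}. x s = y s)" for n
  proof (induction n)
    case 0
    \<comment> \<open>The iteration starts from the initial path continued by its value at 0; its
      image has the same initial segment.\<close>
    define x where "x = restrict (\<lambda>t. \<eta> (min t 0)) {-r..T}"
    have x: "holder_on \<mu> {-r..T} x"
    proof (rule holder_on_glue)
      show "holder_on \<mu> {-r..0} x"
        using \<eta> T by (simp add: holder_on_def x_def)
      show "holder_on \<mu> {0..T} x"
        using holder_on_const[of \<mu> "{0..T}" "\<eta> 0"] r by (simp add: holder_on_def x_def)
    qed (use r T \<mu> in auto)
    then have "x \<in> paths"
      using holder_on_imp_continuous_on[OF \<mu>(1) x] unfolding paths_def mspace_path_space by (simp add: x_def)
    moreover obtain y where y: "holder_on \<mu> {-r..T} y" "solves (driver x) y"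
      using solve[OF x] by blast
    moreover have "x s = y s" if "s \<in> {-r..min (real 0 * r) T}" for s
    proof -
      have "y s = \<eta> s"
        using y(2) that by (simp add: solves_def)
      then show ?thesis
        using that T by (simp add: x_def)
    qed
    ultimately show ?case
      using x by blast
  next
    case (Suc n)
    then obtain x y where xy: "holder_on \<mu> {-r..T} y" "solves (driver x) y"
      "\<And>s. s \<in> {-r..min (real n * r) T} \<Longrightarrow> x s = y s"
      by blast
    obtain y' where y': "holder_on \<mu> {-r..T} y'" "solves (driver y) y'"
      using solve[OF xy(1)] by blast
    have "y \<in> paths"
      using xy(2) by (simp add: solves_def)
    then show ?case
      using step[OF xy(2) y'(2) xy(3)] xy(1) y' by blast
  qed
  obtain x y where x: "holder_on \<mu> {-r..T} x" "x \<in> paths" and y: "solves (driver x) y"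
    and eq: "\<And>s. s \<in> {-r..T} \<Longrightarrow> x s = y s"
    using approx[of N] unfolding min_N by blast
  \<comment> \<open>After \<open>N\<close> steps the agreement covers \<open>[-r,T]\<close>, and
    extensionality turns it into equality: the path \<open>x\<close> is a fixed point of the
    solution map. Its Hoelder regularity ensures that the integrals are defined.\<close>
  have "x = y"
    using eq x(2) y unfolding solves_def paths_def mspace_path_space by (auto intro: extensionalityI)
  with y have "solves (driver x) x"
    by simp
  moreover have "\<forall>t\<in>{0..T}. integrable (lebesgue_on {0..t}) (\<lambda>s. b s (segment r x s))"
    using drift_path_integrable[OF cont[OF x(2)]] by blast
  ultimately have "reflected_delay_solution \<alpha> r T \<eta> b \<sigma> g x"
    using driver_defined[OF x(1)]
    unfolding reflected_delay_solution_def solves_def unref reflect_def paths_def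
    by (elim conjE) (intro conjI; assumption)
  with unique show ?thesis by blast
qed

end
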